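(* Let $d$ be prime, $n\ge1$, $G$ positive and invertible over $\mathbb Z_d$, and $\rho,\sigma$ $n$-qudit states. Then $\rho\boxtimes\sigma$ has minimal entropy (i.e. is a pure state, $H(\rho\boxtimes\sigma)=0$) if and only if $\rho$ and $\sigma$ are pure stabilizer states whose stabilizer groups $S_1$ (of $\rho$) and $S_2$ (of $\sigma$) satisfy $$S_1=\{w(-g_{10}^{-1}g_{11}\vec p,\ g_{01}^{-1}g_{00}\vec q):\ w(\vec p,\vec q)\in S_2\}$$ (as groups of Weyl operators up to phases).
   Context: Fix a prime $d$; $\chi(k)=e^{2\pi ik/d}$, $X|k\rangle=|k+1\rangle$, $Z|k\rangle=\chi(k)|k\rangle$ on $\mathbb C^d$; Weyl operators $w(p,q)=\chi(-2^{-1}pq)Z^pX^q$ (odd $d$), $w(p,q)=i^{-pq}Z^pX^q$ ($d=2$), $w(\vec p,\vec q)=\bigotimes_kw(p_k,q_k)$. A pure stabilizer state is (the projector onto) a common eigenvector of an abelian group of $d^n$ Weyl operators (up to phases), called its stabilizer group. $G=\begin{pmatrix}g_{00}&g_{01}\\ g_{10}&g_{11}\end{pmatrix}$ over $\mathbb Z_d$ with $\det G\not\equiv0$, $N=(\det G)^{-1}$; positive means all entries nonzero mod $d$. Key unitary $U|\vec i\rangle|\vec j\rangle=|Ng_{11}\vec i-Ng_{10}\vec j\rangle|-Ng_{01}\vec i+Ng_{00}\vec j\rangle$; convolution $\rho\boxtimes\sigma=\mathrm{Tr}_B[U(\rho\otimes\sigma)U^\dagger]$. $H$ is von Neumann entropy.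 *)

theory Defs
  imports "Jordan_Normal_Form.Jordan_Normal_Form" "HOL-Number_Theory.Modular_Inverse"
    "HOL-Computational_Algebra.Fundamental_Theorem_Algebra"
begin

text \<open>n-qudit Hilbert space (C^d)^{tensor n} with computational basis indexed by
  i < d^n, the k-th qudit of basis index i being the digit (i div d^k) mod d.
  Weyl labels (p,q) are pairs of functions nat => int with components in {0..<d}
  for k < n and 0 for k >= n. The matrix G is given by four integer entries.\<close>

definition chi :: "nat \<Rightarrow> int \<Rightarrow> complex" where
  "chi d k = exp (2 * of_real pi * \<i> * of_int k / of_nat d)"

definition dig :: "nat \<Rightarrow> nat \<Rightarrow> nat \<Rightarrow> int" where
  "dig d k i = int ((i div d ^ k) mod d)"

definition enc :: "nat \<Rightarrow> nat \<Rightarrow> (nat \<Rightarrow> int) \<Rightarrow> nat" where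
  "enc d n f = nat (\<Sum>k<n. (f k mod int d) * int d ^ k)"

definition weyl_phase :: "nat \<Rightarrow> int \<Rightarrow> int \<Rightarrow> complex" where
  "weyl_phase d p q = (if d = 2 then \<i> powi (- (p * q))
      else chi d (- (modular_inverse (int d) 2) * p * q))"

text \<open>matrix entry <r| w(p,q) |c> of the single-qudit Weyl operator
  w(p,q) = phase * Z^p X^q, where Z^p X^q |c> = chi(p(c+q)) |c+q>\<close>
definition weyl1 :: "nat \<Rightarrow> int \<Rightarrow> int \<Rightarrow> int \<Rightarrow> int \<Rightarrow> complex" where
  "weyl1 d p q r c = (if r = (c + q) mod int d then weyl_phase d p q * chi d (p * (c + q)) else 0)"

definition weyl :: "nat \<Rightarrow> nat \<Rightarrow> (nat \<Rightarrow> int) \<times> (nat \<Rightarrow> int) \<Rightarrow> complex mat" where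
  "weyl d n pq = mat (d ^ n) (d ^ n)
     (\<lambda>(r, c). \<Prod>k<n. weyl1 d (fst pq k) (snd pq k) (dig d k r) (dig d k c))"

definition labels :: "nat \<Rightarrow> nat \<Rightarrow> ((nat \<Rightarrow> int) \<times> (nat \<Rightarrow> int)) set" where
  "labels d n = {(p, q). \<forall>k. (k < n \<longrightarrow> 0 \<le> p k \<and> p k < int d \<and> 0 \<le> q k \<and> q k < int d)
                            \<and> (n \<le> k \<longrightarrow> p k = 0 \<and> q k = 0)}"

definition label_add :: "nat \<Rightarrow> (nat \<Rightarrow> int) \<times> (nat \<Rightarrow> int) \<Rightarrow> (nat \<Rightarrow> int) \<times> (nat \<Rightarrow> int)
    \<Rightarrow> (nat \<Rightarrow> int) \<times> (nat \<Rightarrow> int)" where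
  "label_add d a b = ((\<lambda>k. (fst a k + fst b k) mod int d), (\<lambda>k. (snd a k + snd b k) mod int d))"

definition proj_of :: "nat \<Rightarrow> complex vec \<Rightarrow> complex mat" where
  "proj_of D \<psi> = mat D D (\<lambda>(i, j). \<psi> $ i * cnj (\<psi> $ j))"

text \<open>rho is a pure stabilizer state with stabilizer group S (Weyl labels, i.e. Weyl
  operators up to phases): S is an abelian group of d^n Weyl operators (up to phase)
  and rho = |psi><psi| with psi a normalized common eigenvector of all w in S.\<close>
definition is_pure_stabilizer_state ::
  "nat \<Rightarrow> nat \<Rightarrow> complex mat \<Rightarrow> ((nat \<Rightarrow> int) \<times> (nat \<Rightarrow> int)) set \<Rightarrow> bool" where
  "is_pure_stabilizer_state d n \<rho> S \<longleftrightarrow>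
     S \<subseteq> labels d n \<and> card S = d ^ n \<and> ((\<lambda>k. 0), (\<lambda>k. 0)) \<in> S
     \<and> (\<forall>a\<in>S. \<forall>b\<in>S. label_add d a b \<in> S)
     \<and> (\<forall>a\<in>S. \<forall>b\<in>S. weyl d n a * weyl d n b = weyl d n b * weyl d n a)
     \<and> (\<exists>\<psi>. \<psi> \<in> carrier_vec (d ^ n) \<and> (\<Sum>i<d ^ n. (cmod (\<psi> $ i))\<^sup>2) = 1
            \<and> \<rho> = proj_of (d ^ n) \<psi>
            \<and> (\<forall>a\<in>S. \<exists>c::complex. weyl d n a *\<^sub>v \<psi> = c \<cdot>\<^sub>v \<psi>))"

definition ctrace :: "complex mat \<Rightarrow> complex" where
  "ctrace A = (\<Sum>i<dim_row A. A $$ (i, i))"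

definition adj :: "complex mat \<Rightarrow> complex mat" where
  "adj A = mat (dim_col A) (dim_row A) (\<lambda>(i, j). cnj (A $$ (j, i)))"

definition density_matrix :: "nat \<Rightarrow> complex mat \<Rightarrow> bool" where
  "density_matrix D \<rho> \<longleftrightarrow> \<rho> \<in> carrier_mat D D \<and> adj \<rho> = \<rho>
     \<and> (\<forall>v \<in> carrier_vec D. Re (\<Sum>i<D. \<Sum>j<D. cnj (v $ i) * \<rho> $$ (i, j) * v $ j) \<ge> 0)
     \<and> ctrace \<rho> = 1"

text \<open>Kronecker product, index of |a>|b> is a * dim(B) + b\<close>
definition kron :: "complex mat \<Rightarrow> complex mat \<Rightarrow> complex mat" where
  "kron A B = mat (dim_row A * dim_row B) (dim_col A * dim_col B)
     (\<lambda>(i, j). A $$ (i div dim_row B, j div dim_col B) * B $$ (i mod dim_row B, j mod dim_col B))"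

definition ptrace_B :: "nat \<Rightarrow> complex mat \<Rightarrow> complex mat" where
  "ptrace_B D M = mat D D (\<lambda>(a, a'). \<Sum>b<D. M $$ (a * D + b, a' * D + b))"

definition U_map :: "nat \<Rightarrow> nat \<Rightarrow> int \<Rightarrow> int \<Rightarrow> int \<Rightarrow> int \<Rightarrow> nat \<Rightarrow> nat" where
  "U_map d n g00 g01 g10 g11 c =
     (let D = d ^ n; N = modular_inverse (int d) (g00 * g11 - g01 * g10);
          a = c div D; b = c mod D
      in enc d n (\<lambda>k. N * g11 * dig d k a - N * g10 * dig d k b) * D
         + enc d n (\<lambda>k. - N * g01 * dig d k a + N * g00 * dig d k b))"

definition U_mat :: "nat \<Rightarrow> nat \<Rightarrow> int \<Rightarrow> int \<Rightarrow> int \<Rightarrow> int \<Rightarrow> complex mat" where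
  "U_mat d n g00 g01 g10 g11 = mat (d ^ n * d ^ n) (d ^ n * d ^ n)
     (\<lambda>(r, c). if r = U_map d n g00 g01 g10 g11 c then 1 else 0)"

definition qconv :: "nat \<Rightarrow> nat \<Rightarrow> int \<Rightarrow> int \<Rightarrow> int \<Rightarrow> int \<Rightarrow> complex mat \<Rightarrow> complex mat \<Rightarrow> complex mat" where
  "qconv d n g00 g01 g10 g11 \<rho> \<sigma> =
     (let U = U_mat d n g00 g01 g10 g11 in ptrace_B (d ^ n) (U * kron \<rho> \<sigma> * adj U))"

text \<open>von Neumann entropy: - sum over eigenvalues (with multiplicity, roots of the
  characteristic polynomial) of lambda ln lambda; note ln 0 = 0 in Isabelle.\<close>
definition vN_entropy :: "complex mat \<Rightarrow> real" where
  "vN_entropy \<rho> = - (\<Sum>x\<in>#proots (char_poly \<rho>). Re x * ln (Re x))"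

definition stab_map :: "nat \<Rightarrow> int \<Rightarrow> int \<Rightarrow> int \<Rightarrow> int \<Rightarrow>
    (nat \<Rightarrow> int) \<times> (nat \<Rightarrow> int) \<Rightarrow> (nat \<Rightarrow> int) \<times> (nat \<Rightarrow> int)" where
  "stab_map d g00 g01 g10 g11 pq =
     ((\<lambda>k. (- modular_inverse (int d) g10 * g11 * fst pq k) mod int d),
      (\<lambda>k. (modular_inverse (int d) g01 * g00 * snd pq k) mod int d))"

end

theory Submission
  imports Defs "Jordan_Normal_Form.Schur_Decomposition"
begin

text \<open>
  Write \<open>F(p, q)\<close> for the trace of \<open>\<rho> Z\<^sup>p X\<^sup>q\<close>. For every state \<open>|F| \<le> 1\<close>, and by Parseval the sum
  of \<open>|F|\<^sup>2\<close> over all labels is \<open>d\<^sup>n\<close> times the purity, hence at most \<open>d\<^sup>n\<close>. Under convolution the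
  characteristic functions multiply, after a linear change of labels which \<open>stab_map\<close> describes.
  So the convolution is pure iff the sum of \<open>f g\<close> is \<open>d\<^sup>n\<close> for two functions \<open>f\<close>, \<open>g\<close> with values in
  \<open>[0, 1]\<close> and sums at most \<open>d\<^sup>n\<close>. This forces \<open>f = g\<close> with values in \<open>{0, 1}\<close>: both states are pure,
  and the labels with \<open>|F| = 1\<close>, which by the equality case of Cauchy--Schwarz are those of the Weyl
  operators having the state vector as eigenvector, correspond under \<open>stab_map\<close>. Conversely, the
  \<open>d\<^sup>n\<close> stabilizer labels already contribute \<open>d\<^sup>n\<close> to the sum of \<open>f g\<close>.
\<close>

subsection \<open>Positive semidefinite kernels\<close>

definition quad_form :: "nat \<Rightarrow> (nat \<Rightarrow> nat \<Rightarrow> complex) \<Rightarrow> (nat \<Rightarrow> complex) \<Rightarrow> complex" where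
  "quad_form D K f = (\<Sum>a<D. \<Sum>b<D. cnj (f a) * K a b * f b)"

text \<open>Kernels are plain functions of two indices, so that Schur complements and rank-one terms
  need no matrix bookkeeping; only indices below \<open>D\<close> enter.\<close>

definition psd_kernel :: "nat \<Rightarrow> (nat \<Rightarrow> nat \<Rightarrow> complex) \<Rightarrow> bool" where
  "psd_kernel D K \<longleftrightarrow> (\<forall>i<D. \<forall>j<D. K j i = cnj (K i j)) \<and> (\<forall>f. Re (quad_form D K f) \<ge> 0)"

lemma psd_kernel_cnj: "psd_kernel D K \<Longrightarrow> i < D \<Longrightarrow> j < D \<Longrightarrow> cnj (K i j) = K j i"
  unfolding psd_kernel_def by (metis complex_cnj_cnj)

lemma psd_kernel_quad_form: "psd_kernel D K \<Longrightarrow> Re (quad_form D K f) \<ge> 0"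
  unfolding psd_kernel_def by (elim conjE) (erule spec)

text \<open>Expands the form after subtracting \<open>t\<close> times the \<open>i\<close>-th basis
  vector. Suitable \<open>f\<close> and \<open>t\<close> give nonnegativity of the diagonal,
  vanishing of a row with zero diagonal, and completion of the square.\<close>

lemma quad_form_shift:
  assumes "i < D"
  shows "quad_form D K (\<lambda>a. f a - (if a = i then t else 0)) =
    quad_form D K f - cnj t * (\<Sum>b<D. K i b * f b) - t * (\<Sum>a<D. cnj (f a) * K a i) + cnj t * t * K i i"
proof -
  have inner: "(\<Sum>b<D. K a b * (f b - (if b = i then t else 0))) = (\<Sum>b<D. K a b * f b) - K a i * t" for a
  proof -
    have "(\<Sum>b<D. K a b * (f b - (if b = i then t else 0)))
        = (\<Sum>b<D. K a b * f b) - (\<Sum>b<D. if b = i then K a i * t else 0)"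
      unfolding sum_subtractf[symmetric] by (intro sum.cong) (auto simp: algebra_simps)
    then show ?thesis using assms by simp
  qed
  have "quad_form D K (\<lambda>a. f a - (if a = i then t else 0)) =
      (\<Sum>a<D. cnj (f a - (if a = i then t else 0)) * ((\<Sum>b<D. K a b * f b) - K a i * t))"
    unfolding quad_form_def by (simp only: mult.assoc sum_distrib_left[symmetric] inner)
  also have "\<dots> = (\<Sum>a<D. cnj (f a) * ((\<Sum>b<D. K a b * f b) - K a i * t))
      - (\<Sum>a<D. if a = i then cnj t * ((\<Sum>b<D. K i b * f b) - K i i * t) else 0)"
    unfolding sum_subtractf[symmetric] by (intro sum.cong) (auto simp: algebra_simps)
  also have "\<dots> = (\<Sum>a<D. cnj (f a) * (\<Sum>b<D. K a b * f b)) - t * (\<Sum>a<D. cnj (f a) * K a i)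
      - cnj t * ((\<Sum>b<D. K i b * f b) - K i i * t)"
    using assms by (simp add: right_diff_distrib sum_subtractf sum_distrib_left mult_ac)
  finally show ?thesis
    by (simp add: quad_form_def algebra_simps sum_distrib_left)
qed

lemma psd_kernel_diag:
  assumes "psd_kernel D K" "i < D"
  shows "K i i = of_real (Re (K i i))" "Re (K i i) \<ge> 0"
proof -
  have "cnj (K i i) = K i i" using psd_kernel_cnj[OF assms(1,2,2)] .
  then show "K i i = of_real (Re (K i i))" by (simp add: complex_eq_iff)
  \<comment> \<open>Shifting the zero vector by \<open>-1\<close> produces the \<open>i\<close>-th
    basis vector.\<close>
  have "quad_form D K (\<lambda>a. 0 - (if a = i then -1 else 0)) = K i i"
    by (subst quad_form_shift[OF assms(2)]) (simp add: quad_form_def)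
  then show "Re (K i i) \<ge> 0" using psd_kernel_quad_form[OF assms(1)] by metis
qed

text \<open>With \<open>K i i = 0\<close> the form at \<open>e_j - t e_i\<close> has no quadratic
  term in \<open>t\<close>, so it would be unbounded below if \<open>K i j\<close> were
  nonzero.\<close>

lemma psd_kernel_zero_diag:
  assumes "psd_kernel D K" "i < D" "j < D" "K i i = 0"
  shows "K i j = 0"
proof (rule ccontr)
  assume nz: "K i j \<noteq> 0"
  \<comment> \<open>This size of \<open>t\<close> makes the real part of the form equal to
    \<open>- Re (K j j) - 2\<close>, which is negative.\<close>
  define r where "r = (Re (K j j) + 1) / (cmod (K i j))\<^sup>2"
  define t where "t = of_real r * K i j"
  let ?e = "\<lambda>b::nat. if b = j then 1 else (0::complex)"
  have q: "quad_form D K ?e = K j j"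
    using assms(3) by (simp add: quad_form_def if_distrib[of "\<lambda>x. _ * x"] if_distrib[of "\<lambda>x. x * _"]
        if_distrib[of cnj] cong: if_cong)
  have s1: "(\<Sum>b<D. K i b * ?e b) = K i j" and s2: "(\<Sum>a<D. cnj (?e a) * K a i) = K j i"
    using assms(3) by (simp_all add: if_distrib[of "\<lambda>x. _ * x"] if_distrib[of "\<lambda>x. x * _"]
        if_distrib[of cnj] cong: if_cong)
  have "quad_form D K (\<lambda>a. ?e a - (if a = i then t else 0)) = K j j - cnj t * K i j - t * K j i"
    unfolding quad_form_shift[OF assms(2)] q s1 s2 using assms(4) by simp
  moreover have "K j i = cnj (K i j)" using psd_kernel_cnj[OF assms(1-3)] by simp
  ultimately have "quad_form D K (\<lambda>a. ?e a - (if a = i then t else 0)) = K j j - 2 * of_real r * (K i j * cnj (K i j))"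
    by (simp add: t_def)
  also have "\<dots> = K j j - of_real (2 * r * (cmod (K i j))\<^sup>2)"
    by (simp only: complex_norm_square[symmetric] of_real_mult of_real_numeral mult.assoc)
  finally have "Re (K j j) - 2 * r * (cmod (K i j))\<^sup>2 \<ge> 0"
    using psd_kernel_quad_form[OF assms(1), of "\<lambda>a. ?e a - (if a = i then t else 0)"]
    by simp
  moreover have "r * (cmod (K i j))\<^sup>2 = Re (K j j) + 1" using nz by (simp add: r_def)
  ultimately show False using psd_kernel_diag(2)[OF assms(1,3)] by simp
qed

text \<open>Completing the square: the form of the Schur complement at \<open>f\<close> is the form
  of \<open>K\<close> at \<open>f\<close> with a multiple of the \<open>i\<close>-th basis vector
  subtracted.\<close>

lemma psd_kernel_schur_complement:
  assumes "psd_kernel D K" "i < D" "K i i \<noteq> 0"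
  shows "psd_kernel D (\<lambda>a b. K a b - K a i * K i b / K i i)"
  unfolding psd_kernel_def
proof (intro conjI allI impI)
  fix a b assume "a < D" "b < D"
  then show "K b a - K b i * K i a / K i i = cnj (K a b - K a i * K i b / K i i)"
    using assms by (simp add: psd_kernel_cnj)
next
  fix f
  define s where "s = (\<Sum>b<D. K i b * f b)"
  have cs: "(\<Sum>a<D. cnj (f a) * K a i) = cnj s"
    unfolding s_def cnj_sum using assms by (intro sum.cong) (auto simp: psd_kernel_cnj)
  have ck: "cnj (K i i) = K i i" using psd_kernel_cnj[OF assms(1,2,2)] .
  have "quad_form D (\<lambda>a b. K a b - K a i * K i b / K i i) f
      = quad_form D K f - (\<Sum>a<D. \<Sum>b<D. (cnj (f a) * K a i) * (K i b * f b)) / K i i"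
    by (simp add: quad_form_def algebra_simps sum_subtractf sum_divide_distrib)
  also have "\<dots> = quad_form D K f - cnj s * s / K i i"
    by (simp only: sum_product[symmetric] cs s_def[symmetric])
  \<comment> \<open>The subtracted coefficient \<open>s / K i i\<close> minimizes the form along the
    \<open>i\<close>-th direction.\<close>
  also have "\<dots> = quad_form D K (\<lambda>a. f a - (if a = i then s / K i i else 0))"
    unfolding quad_form_shift[OF assms(2)] s_def[symmetric] cs
    using assms(3) by (simp add: ck field_simps)
  finally show "Re (quad_form D (\<lambda>a b. K a b - K a i * K i b / K i i) f) \<ge> 0"
    using psd_kernel_quad_form[OF assms(1)] by simp
qed

text \<open>The Schur complement at \<open>i\<close> has the nonnegative diagonal entry
  \<open>K j j - |K i j|^2 / K i i\<close>; clearing the denominator gives the inequality.\<close>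

lemma psd_kernel_minor:
  assumes "psd_kernel D K" "i < D" "j < D"
  shows "(cmod (K i j))\<^sup>2 \<le> Re (K i i) * Re (K j j)"
proof (cases "K i i = 0")
  case True
  then show ?thesis using psd_kernel_zero_diag[OF assms True] by simp
next
  case False
  have pos: "Re (K i i) > 0"
    using False psd_kernel_diag[OF assms(1,2)] by (metis less_eq_real_def of_real_0)
  have "K j i * K i j / K i i = of_real ((cmod (K i j))\<^sup>2 / Re (K i i))"
    using psd_kernel_diag(1)[OF assms(1,2)] psd_kernel_cnj[OF assms, symmetric]
    by (metis complex_norm_square mult.commute of_real_divide of_real_power)
  then have "0 \<le> Re (K j j) - (cmod (K i j))\<^sup>2 / Re (K i i)"
    using psd_kernel_diag(2)[OF psd_kernel_schur_complement[OF assms(1,2) False] assms(3)] by simp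
  then show ?thesis using pos by (simp add: field_simps)
qed

text \<open>Gaussian elimination: each Schur complement splits off a rank-one term and lowers the
  number of nonzero diagonal entries. The decomposition later shows that convolution preserves
  positivity.\<close>

lemma psd_kernel_decomposition:
  assumes "psd_kernel D K"
  shows "\<exists>(m::nat) u. \<forall>i<D. \<forall>j<D. K i j = (\<Sum>k<m. u k i * cnj (u k j))"
proof -
  have "\<exists>(m::nat) u. \<forall>i<D. \<forall>j<D. K i j = (\<Sum>k<m. u k i * cnj (u k j))"
    if "psd_kernel D K" "card {i. i < D \<and> K i i \<noteq> 0} = N" for N K
    using that
  proof (induction N arbitrary: K rule: less_induct)
    case (less N)
    note psd = less.prems(1)
    show ?case
    proof (cases "\<exists>i<D. K i i \<noteq> 0")
      case False
      then show ?thesis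
        using psd_kernel_zero_diag[OF psd] by (intro exI[of _ 0]) auto
    next
      case True
      then obtain i where i: "i < D" "K i i \<noteq> 0" by blast
      define L where "L = (\<lambda>a b. K a b - K a i * K i b / K i i)"
      have L: "psd_kernel D L" unfolding L_def by (rule psd_kernel_schur_complement[OF psd i])
      \<comment> \<open>A zero diagonal entry forces \<open>K a i = 0\<close>, so elimination leaves
        that entry zero.\<close>
      have "L a a = 0" if "a < D" "K a a = 0" for a
        using psd_kernel_zero_diag[OF psd that(1) i(1) that(2)] that by (simp add: L_def)
      moreover have "L i i = 0" using i by (simp add: L_def)
      ultimately have "{a. a < D \<and> L a a \<noteq> 0} \<subset> {a. a < D \<and> K a a \<noteq> 0}"
        using i by auto
      then have "card {a. a < D \<and> L a a \<noteq> 0} < card {a. a < D \<and> K a a \<noteq> 0}"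
        by (intro psubset_card_mono) auto
      with less.prems(2) have "card {a. a < D \<and> L a a \<noteq> 0} < N" by simp
      from less.IH[OF this L refl] obtain m :: nat and u where
        mu: "\<forall>a<D. \<forall>b<D. L a b = (\<Sum>k<m. u k a * cnj (u k b))" by (elim exE) (rule that)
      have pos: "Re (K i i) \<ge> 0" "K i i = of_real (Re (K i i))" using psd_kernel_diag[OF psd i(1)] by auto
      \<comment> \<open>The new vector, at index \<open>m\<close>, is column \<open>i\<close>
        divided by the square root of its pivot.\<close>
      define v where "v = (\<lambda>k a. if k < m then u k a else K a i / of_real (sqrt (Re (K i i))))"
      have K: "K a b = (\<Sum>k<Suc m. v k a * cnj (v k b))" if "a < D" "b < D" for a b
      proof -
        have "K a b = L a b + K a i * K i b / K i i" by (simp add: L_def)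
        also have "L a b = (\<Sum>k<m. v k a * cnj (v k b))" using mu that by (simp add: v_def)
        also have "K a i * K i b / K i i = v m a * cnj (v m b)"
        proof -
          have "of_real (sqrt (Re (K i i))) * of_real (sqrt (Re (K i i))) = K i i"
            using pos by (simp flip: of_real_mult)
          then show ?thesis using psd_kernel_cnj[OF psd that(2) i(1)] by (simp add: v_def)
        qed
        finally show ?thesis by simp
      qed
      then show ?thesis by (intro exI[of _ "Suc m"] exI[of _ v] allI impI K)
    qed
  qed
  from this[OF assms refl] show ?thesis .
qed

text \<open>The minor inequality combined with that between geometric and arithmetic mean.\<close>

lemma psd_kernel_norm_le_mean:
  assumes "psd_kernel D K" "i < D" "j < D"
  shows "cmod (K i j) \<le> (Re (K i i) + Re (K j j)) / 2"
proof (rule power2_le_imp_le)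
  have "0 \<le> (Re (K i i) - Re (K j j))\<^sup>2" by simp
  then have "Re (K i i) * Re (K j j) \<le> ((Re (K i i) + Re (K j j)) / 2)\<^sup>2"
    by (simp add: power2_eq_square algebra_simps)
  with psd_kernel_minor[OF assms] show "(cmod (K i j))\<^sup>2 \<le> ((Re (K i i) + Re (K j j)) / 2)\<^sup>2"
    by linarith
  show "0 \<le> (Re (K i i) + Re (K j j)) / 2"
    using psd_kernel_diag(2)[OF assms(1)] assms by simp
qed

lemma sum_Re_diag_prod:
  assumes "(\<Sum>i<D. K i i) = (1::complex)"
  shows "(\<Sum>i<D. \<Sum>j<D. Re (K i i) * Re (K j j)) = 1"
proof -
  have "(\<Sum>i<D. Re (K i i)) = 1" using assms by (simp flip: Re_sum)
  then show ?thesis by (simp flip: sum_product)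
qed

text \<open>Summed over all \<open>i\<close> and \<open>j\<close>, the minor inequality bounds the
  purity by the square of the trace.\<close>

lemma psd_kernel_purity_le_1:
  assumes "psd_kernel D K" "(\<Sum>i<D. K i i) = 1"
  shows "(\<Sum>i<D. \<Sum>j<D. (cmod (K i j))\<^sup>2) \<le> 1"
proof -
  have "(\<Sum>i<D. \<Sum>j<D. (cmod (K i j))\<^sup>2) \<le> (\<Sum>i<D. \<Sum>j<D. Re (K i i) * Re (K j j))"
    using psd_kernel_minor[OF assms(1)] by (intro sum_mono) auto
  then show ?thesis using sum_Re_diag_prod[of K D, OF assms(2)] by simp
qed

text \<open>Purity one forces equality in every 2-by-2 minor, so a Schur complement has zero diagonal
  and therefore vanishes.\<close>

lemma psd_kernel_pure:
  assumes psd: "psd_kernel D K" and tr: "(\<Sum>i<D. K i i) = 1"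
    and pur: "(\<Sum>i<D. \<Sum>j<D. (cmod (K i j))\<^sup>2) = 1"
  shows "\<exists>\<psi>. (\<Sum>i<D. (cmod (\<psi> i))\<^sup>2) = 1 \<and> (\<forall>i<D. \<forall>j<D. K i j = \<psi> i * cnj (\<psi> j))"
proof -
  have gap: "(\<Sum>i<D. \<Sum>j<D. Re (K i i) * Re (K j j) - (cmod (K i j))\<^sup>2) = 0"
    using pur sum_Re_diag_prod[of K D, OF tr] by (simp add: sum_subtractf)
  have eq: "(cmod (K i j))\<^sup>2 = Re (K i i) * Re (K j j)" if "i < D" "j < D" for i j
  proof -
    have nn: "0 \<le> Re (K a a) * Re (K b b) - (cmod (K a b))\<^sup>2" if "a < D" "b < D" for a b
      using psd_kernel_minor[OF psd that] by simp
    from gap have "(\<Sum>j<D. Re (K i i) * Re (K j j) - (cmod (K i j))\<^sup>2) = 0"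
      using that(1) nn by (subst (asm) sum_nonneg_eq_0_iff) (auto intro!: sum_nonneg)
    then have "Re (K i i) * Re (K j j) - (cmod (K i j))\<^sup>2 = 0"
      using that nn by (subst (asm) sum_nonneg_eq_0_iff) auto
    then show ?thesis by simp
  qed
  have "\<exists>i<D. K i i \<noteq> 0" using tr by (metis (no_types, lifting) lessThan_iff sum.neutral zero_neq_one)
  then obtain i where i: "i < D" "K i i \<noteq> 0" by blast
  have pos: "Re (K i i) \<ge> 0" "K i i = of_real (Re (K i i))" using psd_kernel_diag[OF psd i(1)] by auto
  define L where "L = (\<lambda>a b. K a b - K a i * K i b / K i i)"
  have L: "psd_kernel D L" unfolding L_def by (rule psd_kernel_schur_complement[OF psd i])
  \<comment> \<open>For a rank-one kernel, column \<open>i\<close> divided by the square root of its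
    pivot is the state vector up to a phase.\<close>
  define \<psi> where "\<psi> = (\<lambda>a. K a i / of_real (sqrt (Re (K i i))))"
  have prod: "K a i * K i b / K i i = \<psi> a * cnj (\<psi> b)" if "a < D" "b < D" for a b
  proof -
    have "of_real (sqrt (Re (K i i))) * of_real (sqrt (Re (K i i))) = K i i"
      using pos by (simp flip: of_real_mult)
    then show ?thesis using psd_kernel_cnj[OF psd that(2) i(1)] by (simp add: \<psi>_def)
  qed
  have diag: "L a a = 0" if "a < D" for a
  proof -
    have "K a i * K i a = of_real ((cmod (K a i))\<^sup>2)"
      using psd_kernel_cnj[OF psd that i(1)] by (metis complex_norm_square of_real_power)
    also have "\<dots> = K a a * K i i"
      using eq[OF that i(1)] psd_kernel_diag(1)[OF psd that] pos(2) by (metis of_real_mult)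
    finally show ?thesis using i by (simp add: L_def)
  qed
  have K: "K a b = \<psi> a * cnj (\<psi> b)" if "a < D" "b < D" for a b
    using psd_kernel_zero_diag[OF L that diag[OF that(1)]] prod[OF that] by (simp add: L_def)
  have "of_real (\<Sum>a<D. (cmod (\<psi> a))\<^sup>2) = (\<Sum>a<D. K a a)"
    unfolding of_real_sum by (intro sum.cong) (auto simp: K complex_norm_square simp del: of_real_power)
  then have "(\<Sum>a<D. (cmod (\<psi> a))\<^sup>2) = 1" unfolding tr of_real_eq_1_iff .
  then show ?thesis by (intro exI[of _ \<psi>] conjI allI impI K)
qed

text \<open>Carries the kernel lemmas over to density matrices: test vectors and test functions
  enter only through their first \<open>D\<close> values.\<close>

lemma density_matrix_iff_psd_kernel:
  "density_matrix D A \<longleftrightarrow>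
    A \<in> carrier_mat D D \<and> psd_kernel D (\<lambda>i j. A $$ (i, j)) \<and> (\<Sum>i<D. A $$ (i, i)) = 1"
proof (cases "A \<in> carrier_mat D D")
  case A: True
  have 1: "adj A = A \<longleftrightarrow> (\<forall>i<D. \<forall>j<D. A $$ (j, i) = cnj (A $$ (i, j)))" (is "_ \<longleftrightarrow> ?herm")
  proof
    assume eq: "adj A = A"
    have "A $$ (j, i) = cnj (A $$ (i, j))" if "i < D" "j < D" for i j
    proof -
      have "adj A $$ (j, i) = cnj (A $$ (i, j))" using A that by (simp add: adj_def)
      then show ?thesis unfolding eq .
    qed
    then show ?herm by (intro allI impI)
  next
    assume herm: ?herm
    show "adj A = A"
    proof (rule eq_matI)
      fix i j assume "i < dim_row A" "j < dim_col A"
      then have "i < D" "j < D" using A by auto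
      with herm have "A $$ (i, j) = cnj (A $$ (j, i))" by blast
      then show "adj A $$ (i, j) = A $$ (i, j)" using A \<open>i < D\<close> \<open>j < D\<close> by (simp add: adj_def)
    qed (use A in \<open>auto simp: adj_def\<close>)
  qed
  have "(\<forall>v \<in> carrier_vec D. 0 \<le> Re (\<Sum>i<D. \<Sum>j<D. cnj (v $ i) * A $$ (i, j) * v $ j)) \<longleftrightarrow>
     (\<forall>f. 0 \<le> Re (quad_form D (\<lambda>i j. A $$ (i, j)) f))" (is "?L \<longleftrightarrow> ?R")
  proof
    assume ?L
    show ?R
    proof
      fix f
      from \<open>?L\<close>[rule_format, of "vec D f"]
      show "0 \<le> Re (quad_form D (\<lambda>i j. A $$ (i, j)) f)"
        by (simp add: quad_form_def)
    qed
  qed (auto simp: quad_form_def)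
  moreover have "ctrace A = (\<Sum>i<D. A $$ (i, i))" using A by (simp add: ctrace_def)
  ultimately show ?thesis unfolding density_matrix_def psd_kernel_def 1 by (simp only: conj_assoc)
qed (auto simp: density_matrix_def)

subsection \<open>Entropy and purity\<close>

lemma ctrace_mult:
  assumes "A \<in> carrier_mat n m" "B \<in> carrier_mat m n"
  shows "ctrace (A * B) = (\<Sum>i<n. \<Sum>j<m. A $$ (i, j) * B $$ (j, i))"
  using assms by (auto simp: ctrace_def scalar_prod_def atLeast0LessThan intro!: sum.cong)

lemma ctrace_mult_commute:
  assumes "A \<in> carrier_mat n m" "B \<in> carrier_mat m n"
  shows "ctrace (A * B) = ctrace (B * A)"
  unfolding ctrace_mult[OF assms] ctrace_mult[OF assms(2,1)]
  by (subst sum.swap) (simp add: mult.commute)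

lemma sum_list_diag_mat:
  assumes "B \<in> carrier_mat n n"
  shows "sum_list (map f (diag_mat B)) = (\<Sum>i<n. f (B $$ (i, i)))"
  using assms by (simp add: diag_mat_def interv_sum_list_conv_sum_set_nat o_def atLeast0LessThan)

text \<open>Schur triangularization: the trace is invariant under similarity, and for the triangular
  factor both traces are read off its diagonal, which lists the eigenvalues.\<close>

lemma ctrace_eq_eigenvalue_sums:
  fixes A :: "complex mat"
  assumes A: "A \<in> carrier_mat n n" and es: "char_poly A = (\<Prod>e\<leftarrow>es. [:- e, 1:])"
  shows "ctrace A = sum_list es" "ctrace (A * A) = sum_list (map (\<lambda>x. x\<^sup>2) es)"
proof -
  obtain B P Q where sd: "schur_decomposition A es = (B, P, Q)" by (metis prod_cases3)
  from schur_decomposition[OF A es sd] have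
    sim: "similar_mat_wit A B P Q" and ut: "upper_triangular B" and dg: "diag_mat B = es" by auto
  from similar_mat_witD2[OF A sim] have PQ: "P * Q = 1\<^sub>m n" "Q * P = 1\<^sub>m n" "A = P * B * Q"
    and B: "B \<in> carrier_mat n n" and P: "P \<in> carrier_mat n n" and Q: "Q \<in> carrier_mat n n" by auto
  have conj: "ctrace (P * M * Q) = ctrace M" if "M \<in> carrier_mat n n" for M
  proof -
    have "ctrace (P * M * Q) = ctrace (Q * (P * M))"
      by (rule ctrace_mult_commute[of _ n n]) (use P Q that in auto)
    also have "Q * (P * M) = M" using P Q that PQ(2) by (simp flip: assoc_mult_mat)
    finally show ?thesis .
  qed
  have "A * A = P * (B * B) * Q"
  proof -
    have "A * A = P * B * (Q * P) * (B * Q)"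
      unfolding PQ(3) using P Q B by (simp add: assoc_mult_mat[of _ n n _ n _ n])
    also have "\<dots> = P * (B * B) * Q"
      unfolding PQ(2) using P Q B by (simp add: assoc_mult_mat[of _ n n _ n _ n])
    finally show ?thesis .
  qed
  then have "ctrace (A * A) = ctrace (B * B)" using conj[of "B * B"] B by simp
  \<comment> \<open>For \<open>i\<close> different from \<open>j\<close>, one of the two entries
    lies below the diagonal and is zero.\<close>
  also have "\<dots> = (\<Sum>i<n. \<Sum>j<n. if j = i then (B $$ (i, i))\<^sup>2 else 0)"
    unfolding ctrace_mult[OF B B]
  proof (intro sum.cong refl)
    fix i j assume "i \<in> {..<n}" "j \<in> {..<n}"
    then show "B $$ (i, j) * B $$ (j, i) = (if j = i then (B $$ (i, i))\<^sup>2 else 0)"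
      using upper_triangularD[OF ut, of i j] upper_triangularD[OF ut, of j i] B
      by (cases i j rule: linorder_cases) (auto simp: power2_eq_square)
  qed
  also have "\<dots> = sum_list (map (\<lambda>x. x\<^sup>2) es)"
    unfolding dg[symmetric] sum_list_diag_mat[OF B] by simp
  finally show "ctrace (A * A) = sum_list (map (\<lambda>x. x\<^sup>2) es)" .
  show "ctrace A = sum_list es"
    using conj[OF B] PQ(3) sum_list_diag_mat[OF B, of "\<lambda>x. x"] B dg by (simp add: ctrace_def)
qed

text \<open>At an eigenvector the form equals the eigenvalue times the positive squared norm, while
  the form itself is real and nonnegative.\<close>

lemma psd_eigenvalue:
  assumes A: "A \<in> carrier_mat D D" and psd: "psd_kernel D (\<lambda>i j. A $$ (i, j))"
    and ev: "eigenvalue A e"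
  shows "e = of_real (Re e)" "Re e \<ge> 0"
proof -
  from ev A obtain v where v: "v \<in> carrier_vec D" "v \<noteq> 0\<^sub>v D" "A *\<^sub>v v = e \<cdot>\<^sub>v v"
    unfolding eigenvalue_def eigenvector_def by auto
  let ?q = "quad_form D (\<lambda>i j. A $$ (i, j)) (\<lambda>i. v $ i)"
  define s where "s = (\<Sum>i<D. (cmod (v $ i))\<^sup>2)"
  have row: "(\<Sum>j<D. A $$ (i, j) * v $ j) = e * v $ i" if "i < D" for i
  proof -
    have "(A *\<^sub>v v) $ i = (\<Sum>j<D. A $$ (i, j) * v $ j)"
      using A v(1) that by (simp add: scalar_prod_def atLeast0LessThan)
    then show ?thesis using v that by simp
  qed
  have "?q = (\<Sum>i<D. cnj (v $ i) * (\<Sum>j<D. A $$ (i, j) * v $ j))"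
    by (simp add: quad_form_def sum_distrib_left mult.assoc)
  also have "\<dots> = (\<Sum>i<D. e * (v $ i * cnj (v $ i)))"
    by (intro sum.cong) (auto simp: row)
  finally have q: "?q = e * of_real s"
    by (simp add: s_def complex_norm_square sum_distrib_left flip: of_real_power)
  obtain i where "i < D" "v $ i \<noteq> 0" using v(1,2) by (metis carrier_vecD eq_vecI index_zero_vec)
  then have s: "s > 0" unfolding s_def by (intro sum_pos2[of _ i]) auto
  have "cnj ?q = ?q"
  proof -
    have "cnj ?q = (\<Sum>i<D. \<Sum>j<D. cnj (v $ j) * A $$ (j, i) * v $ i)"
      unfolding quad_form_def cnj_sum
      by (intro sum.cong) (auto simp: psd_kernel_cnj[OF psd] mult_ac)
    also have "\<dots> = ?q" unfolding quad_form_def by (rule sum.swap)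
    finally show ?thesis .
  qed
  then have "cnj e = e" using s unfolding q by simp
  then show e: "e = of_real (Re e)" by (simp add: complex_eq_iff)
  have "0 \<le> Re ?q" by (rule psd_kernel_quad_form[OF psd])
  then have "0 \<le> Re e * s" unfolding q by simp
  then show "Re e \<ge> 0" using s by (simp add: zero_le_mult_iff)
qed

text \<open>The eigenvalues are nonnegative with sum 1. Entropy and 1 minus purity are the sums of
  \<open>- x ln x\<close> and \<open>x - x^2\<close> over them; on the unit interval both summands
  are nonnegative and vanish exactly at 0 and 1.\<close>

lemma vN_entropy_eq_0_iff:
  assumes "density_matrix D A"
  shows "vN_entropy A = 0 \<longleftrightarrow> (\<Sum>i<D. \<Sum>j<D. (cmod (A $$ (i, j)))\<^sup>2) = 1"
proof -
  have A: "A \<in> carrier_mat D D" and psd: "psd_kernel D (\<lambda>i j. A $$ (i, j))"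
    and tr: "(\<Sum>i<D. A $$ (i, i)) = 1"
    using assms by (auto simp: density_matrix_iff_psd_kernel)
  obtain es where es: "char_poly A = (\<Prod>e\<leftarrow>es. [:- e, 1:])"
    using char_poly_factorized[OF A] by auto
  define xs where "xs = map Re es"
  have roots: "proots (char_poly A) = mset es"
  proof -
    have "proots (\<Prod>p\<leftarrow>map (\<lambda>e. [:- e, 1:]) es. p) = (\<Sum>p\<leftarrow>map (\<lambda>e. [:- e, 1:]) es. proots p)"
      by (rule proots_prod_list) auto
    also have "\<dots> = mset es" by (induction es) auto
    finally show ?thesis by (simp add: es)
  qed
  have "eigenvalue A e" if "e \<in> set es" for e
    unfolding eigenvalue_root_char_poly[OF A] es using that by (simp add: poly_prod_list_zero_iff)
  then have e: "e = of_real (Re e)" "Re e \<ge> 0" if "e \<in> set es" for e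
    using psd_eigenvalue[OF A psd] that by blast+
  have es_xs: "es = map of_real xs" unfolding xs_def using e(1) by (simp add: map_idI)
  have "sum_list es = 1" using ctrace_eq_eigenvalue_sums(1)[OF A es] tr A by (simp add: ctrace_def)
  then have sum1: "sum_list xs = 1"
    by (metis Re_complex_of_real es_xs of_real_1 sum_list_of_real)
  have nn: "x \<ge> 0" if "x \<in> set xs" for x using e that by (auto simp: xs_def)
  have le1: "x \<le> 1" if "x \<in> set xs" for x
    using member_le_sum_list[OF that] sum1 nn by simp
  have "of_real (\<Sum>i<D. \<Sum>j<D. (cmod (A $$ (i, j)))\<^sup>2) = ctrace (A * A)"
    unfolding ctrace_mult[OF A A] of_real_sum
    by (intro sum.cong) (auto simp: complex_norm_square psd_kernel_cnj[OF psd] simp del: of_real_power)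
  also have "\<dots> = of_real (sum_list (map (\<lambda>x. x\<^sup>2) xs))"
    unfolding ctrace_eq_eigenvalue_sums(2)[OF A es] es_xs by (induction xs) auto
  finally have pur: "(\<Sum>i<D. \<Sum>j<D. (cmod (A $$ (i, j)))\<^sup>2) = sum_list (map (\<lambda>x. x\<^sup>2) xs)"
    using of_real_eq_iff by blast
  have ent: "vN_entropy A = sum_list (map (\<lambda>x. - (x * ln x)) xs)"
    unfolding vN_entropy_def roots xs_def
    by (simp add: sum_mset_sum_list o_def uminus_sum_list_map flip: mset_map)
  have "x * ln x \<le> 0" if "x \<in> set xs" for x
    using nn[OF that] le1[OF that] by (cases "x = 0") (auto intro: mult_nonneg_nonpos)
  then have "vN_entropy A = 0 \<longleftrightarrow> (\<forall>x\<in>set xs. x * ln x = 0)"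
    unfolding ent by (subst sum_list_nonneg_eq_0_iff) auto
  also have "\<dots> \<longleftrightarrow> (\<forall>x\<in>set xs. x - x\<^sup>2 = 0)"
  proof (intro ball_cong refl)
    fix x assume "x \<in> set xs"
    then have "x \<ge> 0" by (rule nn)
    moreover have "x - x\<^sup>2 = x * (1 - x)" by (simp add: power2_eq_square algebra_simps)
    ultimately show "x * ln x = 0 \<longleftrightarrow> x - x\<^sup>2 = 0" by (cases "x = 0") auto
  qed
  also have "\<dots> \<longleftrightarrow> sum_list (map (\<lambda>x. x - x\<^sup>2) xs) = 0"
    using nn le1 by (subst sum_list_nonneg_eq_0_iff) (auto simp: power2_eq_square mult_left_le)
  also have "sum_list (map (\<lambda>x. x - x\<^sup>2) xs) = 1 - sum_list (map (\<lambda>x. x\<^sup>2) xs)"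
    using sum1 by (simp add: sum_list_subtractf)
  finally show ?thesis using pur by simp
qed

subsection \<open>Characters and Parseval identity\<close>

lemma chi_eq_cis: "chi d k = cis (2 * pi * of_int k / of_nat d)"
  by (simp add: chi_def cis_conv_exp mult_ac)

lemma chi_add: "chi d (a + b) = chi d a * chi d b"
  by (simp add: chi_eq_cis cis_mult ring_distribs add_divide_distrib)

lemma chi_0 [simp]: "chi d 0 = 1"
  by (simp add: chi_def)

lemma chi_minus: "chi d (- a) = cnj (chi d a)"
  by (simp add: chi_eq_cis cis_cnj)

lemma norm_chi [simp]: "cmod (chi d a) = 1"
  by (simp add: chi_eq_cis)

lemma chi_eq_1_iff:
  assumes "d > 0"
  shows "chi d a = 1 \<longleftrightarrow> int d dvd a"
proof -
  have "chi d a = 1 \<longleftrightarrow> cos (2 * pi * of_int a / of_nat d) = 1"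
    using cos_one_sin_zero by (auto simp: chi_eq_cis complex_eq_iff)
  also have "\<dots> \<longleftrightarrow> (\<exists>m::int. 2 * pi * of_int a / of_nat d = of_int m * 2 * pi)"
    by (rule cos_one_2pi_int)
  also have "\<dots> \<longleftrightarrow> (\<exists>m::int. of_int a = (of_int (int d * m) :: real))"
    using assms by (simp add: field_simps)
  also have "\<dots> \<longleftrightarrow> int d dvd a"
    unfolding of_int_eq_iff dvd_def ..
  finally show ?thesis .
qed

lemma chi_cong:
  assumes "d > 0" "a mod int d = b mod int d"
  shows "chi d a = chi d b"
proof -
  have "chi d (a - b) = 1" using assms by (simp add: chi_eq_1_iff mod_eq_dvd_iff)
  then show ?thesis using chi_add[of d "a - b" b] by simp
qed

section \<open>Base-\<open>d\<close> digits and the indices of basis states\<close>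

lemma digit_sum_bounds:
  fixes m :: "nat \<Rightarrow> int"
  assumes "\<And>k. k < n \<Longrightarrow> 0 \<le> m k \<and> m k < int d"
  shows "0 \<le> (\<Sum>k<n. m k * int d ^ k) \<and> (\<Sum>k<n. m k * int d ^ k) < int d ^ n"
  using assms
proof (induction n)
  case (Suc n)
  then have IH: "0 \<le> (\<Sum>k<n. m k * int d ^ k)" "(\<Sum>k<n. m k * int d ^ k) < int d ^ n"
    and m: "0 \<le> m n" "m n \<le> int d - 1" using Suc.prems[of n] by auto
  have "m n * int d ^ n \<le> (int d - 1) * int d ^ n" using m(2) by (intro mult_right_mono) auto
  then show ?case using IH m(1) by (simp add: algebra_simps)
qed simp

lemma digit_sum_digit:
  fixes m :: "nat \<Rightarrow> int"
  assumes "\<And>k. k < n \<Longrightarrow> 0 \<le> m k \<and> m k < int d" "k < n" "d > 0"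
  shows "(\<Sum>k<n. m k * int d ^ k) div int d ^ k mod int d = m k"
  using assms
proof (induction n)
  case (Suc n)
  let ?S = "\<Sum>k<n. m k * int d ^ k"
  have b: "0 \<le> ?S" "?S < int d ^ n" using digit_sum_bounds[of n m d] Suc.prems(1) by auto
  show ?case
  proof (cases "k < n")
    case True
    then obtain l where l: "n = k + Suc l" using less_iff_Suc_add by auto
    \<comment> \<open>The top digit contributes a multiple of \<open>d ^ (k + 1)\<close>, invisible
      to digit \<open>k\<close>.\<close>
    have "m n * int d ^ n = (m n * int d ^ l * int d) * int d ^ k" by (simp add: l power_add)
    then have "(?S + m n * int d ^ n) div int d ^ k = ?S div int d ^ k + m n * int d ^ l * int d"
      using Suc.prems(3) by (simp only: div_mult_self1 power_not_zero of_nat_eq_0_iff not_False_eq_True neq0_conv)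
    then show ?thesis using Suc True by simp
  next
    case False
    then have k: "k = n" using Suc.prems(2) by simp
    have "(?S + m n * int d ^ n) div int d ^ n = m n" using b Suc.prems(3) by simp
    then show ?thesis using Suc.prems(1)[of n] by (simp add: k)
  qed
qed simp

text \<open>Every vector of residues mod \<open>d\<close> has exactly one representative here, since
  values beyond \<open>n\<close> are fixed to zero.\<close>

definition digits :: "nat \<Rightarrow> nat \<Rightarrow> (nat \<Rightarrow> int) set" where
  "digits d n = {p. \<forall>k. (k < n \<longrightarrow> 0 \<le> p k \<and> p k < int d) \<and> (n \<le> k \<longrightarrow> p k = 0)}"

lemma labels_eq: "labels d n = digits d n \<times> digits d n"
  by (auto simp: labels_def digits_def)

locale qudits =
  fixes d n :: nat
  assumes prime_d: "prime d"
begin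

abbreviation D :: nat where "D \<equiv> d ^ n"

lemma d_pos [simp]: "d > 0" using prime_d prime_gt_0_nat by blast

lemma d_neq_0 [simp]: "d \<noteq> 0" using d_pos by (rule less_imp_neq[symmetric])

lemma D_pos [simp]: "D > 0" by simp

lemma enc_less [simp]: "enc d n f < D"
proof -
  have "0 \<le> (\<Sum>k<n. f k mod int d * int d ^ k) \<and> (\<Sum>k<n. f k mod int d * int d ^ k) < int d ^ n"
    by (rule digit_sum_bounds) simp
  then show ?thesis unfolding enc_def by (simp add: nat_less_iff)
qed

lemma dig_enc [simp]: "k < n \<Longrightarrow> dig d k (enc d n f) = f k mod int d"
proof -
  assume k: "k < n"
  have "0 \<le> (\<Sum>k<n. f k mod int d * int d ^ k)"
    using digit_sum_bounds[of n "\<lambda>k. f k mod int d" d] by simp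
  then show ?thesis
    using digit_sum_digit[of n "\<lambda>k. f k mod int d" d k] k
    by (simp add: dig_def enc_def of_nat_mod of_nat_div)
qed

lemma dig_bounds [simp]: "0 \<le> dig d k i" "dig d k i < int d"
  by (auto simp: dig_def)

lemma dig_mod [simp]: "dig d k i mod int d = dig d k i"
  by simp

lemma enc_dig:
  assumes "i < D"
  shows "enc d n (\<lambda>k. dig d k i) = i"
proof -
  have "(\<Sum>k<m. dig d k i * int d ^ k) = int i mod int d ^ m" for m
  proof (induction m)
    case (Suc m)
    have "int i mod (int d ^ m * int d) = int d ^ m * (int i div int d ^ m mod int d) + int i mod int d ^ m"
      by (rule zmod_zmult2_eq) simp
    then show ?case using Suc by (simp add: dig_def of_nat_mod of_nat_div mult_ac)
  qed simp
  from this[of n] have "(\<Sum>k<n. dig d k i * int d ^ k) = int i mod int (d ^ n)" by simp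
  also have "\<dots> = int i" using assms by (metis mod_less of_nat_mod)
  finally show ?thesis by (simp add: enc_def)
qed

lemma enc_cong: "(\<And>k. k < n \<Longrightarrow> f k mod int d = g k mod int d) \<Longrightarrow> enc d n f = enc d n g"
  unfolding enc_def by (intro arg_cong[of _ _ nat] sum.cong) auto

lemma enc_eqI:
  assumes "i < D" "\<And>k. k < n \<Longrightarrow> f k mod int d = dig d k i"
  shows "enc d n f = i"
proof -
  have "enc d n f = enc d n (\<lambda>k. dig d k i)" by (rule enc_cong) (simp add: assms)
  then show ?thesis by (simp add: enc_dig[OF assms(1)])
qed

lemma index_eqI: "i < D \<Longrightarrow> j < D \<Longrightarrow> (\<And>k. k < n \<Longrightarrow> dig d k i = dig d k j) \<Longrightarrow> i = j"
  using enc_eqI[of j "\<lambda>k. dig d k i"] enc_dig[of i] by simp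

section \<open>Shifts and characters on basis indices\<close>

definition unshift :: "nat \<Rightarrow> (nat \<Rightarrow> int) \<Rightarrow> nat" where
  "unshift i q = enc d n (\<lambda>k. dig d k i - q k)"

text \<open>These are the diagonal entries of \<open>Z^p\<close>, while \<open>unshift\<close> gives
  the column of the nonzero entry in each row of \<open>X^q\<close>.\<close>

definition character :: "(nat \<Rightarrow> int) \<Rightarrow> nat \<Rightarrow> complex" where
  "character p i = chi d (\<Sum>k<n. p k * dig d k i)"

lemma unshift_less [simp]: "unshift i q < D"
  by (simp add: unshift_def)

lemma dig_unshift: "k < n \<Longrightarrow> dig d k (unshift i q) = (dig d k i - q k) mod int d"
  by (simp add: unshift_def)

lemma unshift_unshift: "unshift (unshift i q) q' = unshift i (\<lambda>k. q k + q' k)"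
  by (rule index_eqI) (auto simp: dig_unshift mod_simps diff_diff_eq)

lemma unshift_0: "i < D \<Longrightarrow> unshift i (\<lambda>k. 0) = i"
  by (rule index_eqI) (auto simp: dig_unshift)

lemma unshift_cong: "(\<And>k. k < n \<Longrightarrow> q k mod int d = q' k mod int d) \<Longrightarrow> unshift i q = unshift i q'"
  unfolding unshift_def by (rule enc_cong) (metis mod_diff_right_eq)

lemma bij_unshift: "bij_betw (\<lambda>i. unshift i q) {..<D} {..<D}"
  by (rule bij_betwI[where g = "\<lambda>i. unshift i (\<lambda>k. - q k)"]) (auto simp: unshift_unshift unshift_0)

text \<open>The shift is recovered as the digitwise difference of the two indices. This counts
  \<open>digits\<close> and turns sums over shifts into sums over matrix rows.\<close>

lemma bij_unshift_digits:
  assumes r: "r < D"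
  shows "bij_betw (\<lambda>q. unshift r q) (digits d n) {..<D}"
proof (rule bij_betwI[where g = "\<lambda>i k. if k < n then (dig d k r - dig d k i) mod int d else 0"])
  show "unshift r (\<lambda>k. if k < n then (dig d k r - dig d k i) mod int d else 0) = i" if "i \<in> {..<D}" for i
    using that by (intro index_eqI) (auto simp: dig_unshift mod_simps)
  show "(\<lambda>k. if k < n then (dig d k r - dig d k (unshift r q)) mod int d else 0) = q"
    if "q \<in> digits d n" for q
    using that by (auto simp: dig_unshift mod_simps digits_def fun_eq_iff)
qed (auto simp: digits_def)

lemma finite_digits [simp]: "finite (digits d n)"
  using bij_betw_finite[OF bij_unshift_digits[OF D_pos]] by simp

lemma card_digits: "card (digits d n) = D"
  using bij_betw_same_card[OF bij_unshift_digits[OF D_pos]] by simp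

lemma finite_labels [simp]: "finite (labels d n)"
  by (simp add: labels_eq)

lemma norm_character [simp]: "cmod (character p i) = 1"
  by (simp add: character_def)

lemma character_enc: "character p (enc d n f) = chi d (\<Sum>k<n. p k * f k)"
  unfolding character_def
proof (rule chi_cong)
  have "(\<Sum>k<n. p k * dig d k (enc d n f)) mod int d = (\<Sum>k<n. p k * (f k mod int d) mod int d) mod int d"
    by (simp add: mod_sum_eq)
  also have "\<dots> = (\<Sum>k<n. p k * f k) mod int d"
    by (simp add: mod_mult_right_eq mod_sum_eq)
  finally show "(\<Sum>k<n. p k * dig d k (enc d n f)) mod int d = (\<Sum>k<n. p k * f k) mod int d" .
qed simp

text \<open>The scalar form of the commutation relation between \<open>Z^p\<close> and
  \<open>X^q\<close>.\<close>

lemma character_unshift: "character p (unshift i q) = chi d (- (\<Sum>k<n. p k * q k)) * character p i"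
  unfolding unshift_def character_enc
  by (simp add: character_def right_diff_distrib sum_subtractf flip: chi_add)

lemma character_add: "character (\<lambda>k. p k + p' k) i = character p i * character p' i"
  by (simp add: character_def ring_distribs sum.distrib chi_add)

lemma character_cong:
  assumes "\<And>k. k < n \<Longrightarrow> p k mod int d = p' k mod int d"
  shows "character p i = character p' i"
  unfolding character_def
proof (rule chi_cong)
  have "(\<Sum>k<n. p k * dig d k i) mod int d = (\<Sum>k<n. p k * dig d k i mod int d) mod int d"
    by (simp add: mod_sum_eq)
  also have "\<dots> = (\<Sum>k<n. p' k * dig d k i mod int d) mod int d"
    using assms by (intro arg_cong[of _ _ "\<lambda>x. x mod int d"] sum.cong mod_mult_cong assms refl) auto
  finally show "(\<Sum>k<n. p k * dig d k i) mod int d = (\<Sum>k<n. p' k * dig d k i) mod int d"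
    by (simp add: mod_sum_eq)
qed simp

text \<open>If \<open>r\<close> and \<open>s\<close> differ in digit \<open>l\<close>, raising
  \<open>p l\<close> by one permutes \<open>digits\<close> and multiplies the sum by a root of unity
  other than 1, so the sum is zero.\<close>

lemma character_orthogonal:
  assumes "r < D" "s < D"
  shows "(\<Sum>p\<in>digits d n. character p r * cnj (character p s)) = (if r = s then of_nat D else 0)"
proof (cases "r = s")
  case True
  then have "character p r * cnj (character p s) = 1" for p
    by (simp add: complex_norm_square[symmetric])
  then show ?thesis using True by (simp add: card_digits)
next
  case False
  then obtain l where l: "l < n" "dig d l r \<noteq> dig d l s" using index_eqI assms by blast
  let ?sh = "\<lambda>p. p(l := (p l + 1) mod int d)"
  let ?z = "chi d (dig d l r - dig d l s)"
  let ?t = "\<lambda>p. character p r * cnj (character p s)"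
  have bij: "bij_betw ?sh (digits d n) (digits d n)"
    by (rule bij_betwI[where g = "\<lambda>p. p(l := (p l - 1) mod int d)"])
      (use l(1) in \<open>auto simp: digits_def mod_simps fun_eq_iff\<close>)
  have sh: "character (?sh p) i = character p i * chi d (dig d l i)" for p i
  proof -
    have "character (?sh p) i = character (\<lambda>k. p k + (if k = l then 1 else 0)) i"
      by (rule character_cong) auto
    also have "\<dots> = character p i * chi d (dig d l i)"
      unfolding character_add using l(1) by (simp add: character_def if_distrib[of "\<lambda>x. x * _"] cong: if_cong)
    finally show ?thesis .
  qed
  have "(\<Sum>p\<in>digits d n. ?t p) = (\<Sum>p\<in>digits d n. ?t (?sh p))"
    by (rule sum.reindex_bij_betw[OF bij, symmetric])
  also have "\<dots> = ?z * (\<Sum>p\<in>digits d n. ?t p)"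
    unfolding sh sum_distrib_left using chi_add[of d "dig d l r" "- dig d l s"]
    by (simp add: chi_minus mult_ac)
  finally have "(1 - ?z) * (\<Sum>p\<in>digits d n. ?t p) = 0" by (simp add: algebra_simps)
  moreover have "?z \<noteq> 1"
    using l(2) dig_mod[of l r] dig_mod[of l s] by (simp add: chi_eq_1_iff del: dig_mod flip: mod_eq_dvd_iff) 
  ultimately show ?thesis using False by simp
qed

lemma character_parseval:
  "(\<Sum>p\<in>digits d n. (cmod (\<Sum>r<D. f r * character p r))\<^sup>2) = real D * (\<Sum>r<D. (cmod (f r))\<^sup>2)"
proof -
  have "complex_of_real (\<Sum>p\<in>digits d n. (cmod (\<Sum>r<D. f r * character p r))\<^sup>2)
      = (\<Sum>p\<in>digits d n. \<Sum>r<D. \<Sum>s<D. f r * cnj (f s) * (character p r * cnj (character p s)))"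
    by (simp add: complex_norm_square sum_product mult_ac flip: of_real_power del: of_real_power)
  also have "\<dots> = (\<Sum>r<D. \<Sum>s<D. f r * cnj (f s) * (\<Sum>p\<in>digits d n. character p r * cnj (character p s)))"
    unfolding sum_distrib_left by (simp only: sum.swap[of _ _ "digits d n"])
  also have "\<dots> = (\<Sum>r<D. \<Sum>s<D. if r = s then f r * cnj (f r) * of_nat D else 0)"
    by (intro sum.cong refl) (auto simp: character_orthogonal)
  also have "\<dots> = of_real (real D * (\<Sum>r<D. (cmod (f r))\<^sup>2))"
    by (simp add: complex_norm_square[symmetric] sum_distrib_left mult_ac)
  finally show ?thesis using of_real_eq_iff by blast
qed

text \<open>\<open>charfn R (p, q)\<close> is the trace of \<open>R Z\<^sup>p X\<^sup>q\<close>, that is, the characteristic function of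
  \<open>R\<close> without the phase of the Weyl operator.\<close>

definition charfn :: "(nat \<Rightarrow> nat \<Rightarrow> complex) \<Rightarrow> (nat \<Rightarrow> int) \<times> (nat \<Rightarrow> int) \<Rightarrow> complex" where
  "charfn R a = (\<Sum>r<D. R (unshift r (snd a)) r * character (fst a) r)"

text \<open>For fixed \<open>q\<close>, \<open>charfn\<close> is the Fourier transform in
  \<open>p\<close> of one cyclic diagonal of \<open>R\<close>. Parseval applies to each diagonal,
  and the diagonals together run through every entry once.\<close>

lemma charfn_parseval:
  "(\<Sum>a\<in>labels d n. (cmod (charfn R a))\<^sup>2) = real D * (\<Sum>i<D. \<Sum>j<D. (cmod (R i j))\<^sup>2)"
proof -
  have "(\<Sum>a\<in>labels d n. (cmod (charfn R a))\<^sup>2)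
      = (\<Sum>p\<in>digits d n. \<Sum>q\<in>digits d n. (cmod (\<Sum>r<D. R (unshift r q) r * character p r))\<^sup>2)"
    by (simp add: labels_eq sum.cartesian_product charfn_def case_prod_unfold)
  also have "\<dots> = (\<Sum>q\<in>digits d n. real D * (\<Sum>r<D. (cmod (R (unshift r q) r))\<^sup>2))"
    by (subst sum.swap) (simp only: character_parseval)
  also have "\<dots> = real D * (\<Sum>r<D. \<Sum>q\<in>digits d n. (cmod (R (unshift r q) r))\<^sup>2)"
    unfolding sum_distrib_left by (rule sum.swap)
  also have "(\<Sum>r<D. \<Sum>q\<in>digits d n. (cmod (R (unshift r q) r))\<^sup>2) = (\<Sum>r<D. \<Sum>i<D. (cmod (R i r))\<^sup>2)"
    by (intro sum.cong refl sum.reindex_bij_betw bij_unshift_digits) auto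
  also have "\<dots> = (\<Sum>i<D. \<Sum>j<D. (cmod (R i j))\<^sup>2)" by (rule sum.swap)
  finally show ?thesis .
qed

end

subsection \<open>Weyl operators and stabilizer states\<close>

lemma chi_sum: "chi d (\<Sum>k\<in>A. f k) = (\<Prod>k\<in>A. chi d (f k))"
  by (induction A rule: infinite_finite_induct) (auto simp: chi_add)

lemma norm_weyl_phase: "cmod (weyl_phase d p q) = 1"
  by (simp add: weyl_phase_def norm_power_int)

lemma mod_add_eq_iff_mod_diff_eq:
  fixes r c q m :: int
  assumes "0 \<le> r" "r < m" "0 \<le> c" "c < m"
  shows "r = (c + q) mod m \<longleftrightarrow> c = (r - q) mod m"
  using assms by (auto simp: mod_simps)

text \<open>The equality case of Cauchy--Schwarz: the squared norm of
  \<open>\<phi> - z \<psi>\<close> expands to \<open>1 - |z|^2\<close>, which is zero.\<close>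

lemma unit_vectors_parallel:
  fixes \<psi> \<phi> :: "nat \<Rightarrow> complex"
  assumes "(\<Sum>r<D. (cmod (\<psi> r))\<^sup>2) = 1" "(\<Sum>r<D. (cmod (\<phi> r))\<^sup>2) = 1"
    and z: "z = (\<Sum>r<D. \<phi> r * cnj (\<psi> r))" "cmod z = 1"
  shows "\<forall>r<D. \<phi> r = z * \<psi> r"
proof -
  have zz: "cnj z * z = 1" using z(2) complex_norm_square[of z] by (simp add: mult.commute)
  have "complex_of_real (\<Sum>r<D. (cmod (\<phi> r - z * \<psi> r))\<^sup>2)
      = (\<Sum>r<D. of_real ((cmod (\<phi> r))\<^sup>2) - cnj z * (\<phi> r * cnj (\<psi> r)) - z * cnj (\<phi> r * cnj (\<psi> r))
          + (cnj z * z) * of_real ((cmod (\<psi> r))\<^sup>2))"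
    unfolding of_real_sum complex_norm_square by (intro sum.cong) (auto simp: algebra_simps)
  also have "\<dots> = of_real (\<Sum>r<D. (cmod (\<phi> r))\<^sup>2) - cnj z * z - z * cnj z + (cnj z * z) * of_real (\<Sum>r<D. (cmod (\<psi> r))\<^sup>2)"
    unfolding sum.distrib sum_subtractf z(1) of_real_sum cnj_sum sum_distrib_left ..
  also have "\<dots> = 0" using assms(1,2) zz by (simp add: mult.commute)
  finally have "(\<Sum>r<D. (cmod (\<phi> r - z * \<psi> r))\<^sup>2) = 0" using of_real_eq_0_iff by blast
  then show ?thesis by (simp add: sum_nonneg_eq_0_iff)
qed

context qudits
begin

definition label_phase :: "(nat \<Rightarrow> int) \<times> (nat \<Rightarrow> int) \<Rightarrow> complex" where
  "label_phase a = (\<Prod>k<n. weyl_phase d (fst a k) (snd a k))"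

lemma norm_label_phase [simp]: "cmod (label_phase a) = 1"
  by (simp add: label_phase_def norm_weyl_phase flip: prod_norm)

lemma label_phase_nonzero [simp]: "label_phase a \<noteq> 0"
  using norm_label_phase[of a] by fastforce

text \<open>The tensor factors are all nonzero only if every digit of \<open>r\<close> is that of
  \<open>c\<close> shifted by \<open>q\<close>, so each row has a single nonzero entry; the phases
  and characters of the factors multiply.\<close>

lemma weyl_entry:
  assumes "r < D" "c < D"
  shows "weyl d n a $$ (r, c) =
    (if c = unshift r (snd a) then label_phase a * character (fst a) r else 0)"
proof (cases "\<forall>k<n. dig d k r = (dig d k c + snd a k) mod int d")
  case True
  then have "dig d k c = (dig d k r - snd a k) mod int d" if "k < n" for k
    using that by (subst mod_add_eq_iff_mod_diff_eq[symmetric]) auto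
  then have c: "c = unshift r (snd a)" using assms by (intro index_eqI) (auto simp: dig_unshift)
  have "weyl1 d (fst a k) (snd a k) (dig d k r) (dig d k c)
      = weyl_phase d (fst a k) (snd a k) * chi d (fst a k * dig d k r)" if "k < n" for k
  proof -
    have r: "dig d k r = (dig d k c + snd a k) mod int d" using True that by blast
    have "chi d (fst a k * (dig d k c + snd a k)) = chi d (fst a k * dig d k r)"
      unfolding r by (rule chi_cong) (auto simp: mod_simps)
    then show ?thesis using r by (simp add: weyl1_def)
  qed
  then show ?thesis using assms c
    by (simp add: weyl_def label_phase_def character_def chi_sum prod.distrib)
next
  case False
  then obtain k where k: "k < n" "dig d k r \<noteq> (dig d k c + snd a k) mod int d" by blast
  then have "dig d k c \<noteq> (dig d k r - snd a k) mod int d"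
    by (subst mod_add_eq_iff_mod_diff_eq[symmetric]) auto
  then have "c \<noteq> unshift r (snd a)" using k(1) by (auto simp: dig_unshift)
  moreover have "(\<Prod>k<n. weyl1 d (fst a k) (snd a k) (dig d k r) (dig d k c)) = 0"
    using k by (intro prod_zero) (auto simp: weyl1_def)
  ultimately show ?thesis using assms by (simp add: weyl_def)
qed

lemma weyl_mult_vec:
  assumes "\<psi> \<in> carrier_vec D" "r < D"
  shows "(weyl d n a *\<^sub>v \<psi>) $ r = label_phase a * (character (fst a) r * \<psi> $ unshift r (snd a))"
proof -
  have "(weyl d n a *\<^sub>v \<psi>) $ r = (\<Sum>c<D. weyl d n a $$ (r, c) * \<psi> $ c)"
    using assms by (simp add: weyl_def scalar_prod_def atLeast0LessThan)
  also have "\<dots> = (\<Sum>c<D. if c = unshift r (snd a) then label_phase a * character (fst a) r * \<psi> $ c else 0)"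
    by (intro sum.cong) (auto simp: weyl_entry assms)
  finally show ?thesis by (simp add: mult.assoc)
qed

lemma weyl_mult_entry:
  assumes "r < D" "c < D"
  shows "(weyl d n a * weyl d n b) $$ (r, c) =
    (if c = unshift r (\<lambda>k. snd a k + snd b k)
     then label_phase a * label_phase b * chi d (- (\<Sum>k<n. fst b k * snd a k))
        * (character (fst a) r * character (fst b) r) else 0)"
proof -
  have "(weyl d n a * weyl d n b) $$ (r, c) = (\<Sum>l<D. weyl d n a $$ (r, l) * weyl d n b $$ (l, c))"
    using assms by (simp add: weyl_def scalar_prod_def atLeast0LessThan)
  also have "\<dots> = (\<Sum>l<D. if l = unshift r (snd a) then
      label_phase a * character (fst a) r * weyl d n b $$ (l, c) else 0)"
    by (intro sum.cong) (auto simp: weyl_entry assms)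
  also have "\<dots> = label_phase a * character (fst a) r * weyl d n b $$ (unshift r (snd a), c)"
    by simp
  finally show ?thesis
    using assms by (simp add: weyl_entry unshift_unshift character_unshift)
qed

text \<open>The two products have the same support, phases and characters; they differ only in the
  factor from moving \<open>Z\<close> of one operator past \<open>X\<close> of the other.\<close>

lemma weyl_commute:
  assumes "chi d (\<Sum>k<n. fst b k * snd a k) = chi d (\<Sum>k<n. fst a k * snd b k)"
  shows "weyl d n a * weyl d n b = weyl d n b * weyl d n a"
proof (rule eq_matI)
  fix r c assume "r < dim_row (weyl d n b * weyl d n a)" "c < dim_col (weyl d n b * weyl d n a)"
  then have "r < D" "c < D" by (auto simp: weyl_def)
  then show "(weyl d n a * weyl d n b) $$ (r, c) = (weyl d n b * weyl d n a) $$ (r, c)"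
    using assms by (simp add: weyl_mult_entry chi_minus add.commute mult_ac)
qed (auto simp: weyl_def)

section \<open>Eigenvectors of Weyl operators\<close>

text \<open>The eigenvector equation for \<open>Z^p X^q\<close> without the Weyl phase, which would
  only rescale the eigenvalue.\<close>

definition zx_eigen :: "(nat \<Rightarrow> complex) \<Rightarrow> (nat \<Rightarrow> int) \<times> (nat \<Rightarrow> int) \<Rightarrow> complex \<Rightarrow> bool" where
  "zx_eigen \<psi> a c \<longleftrightarrow> (\<forall>r<D. character (fst a) r * \<psi> (unshift r (snd a)) = c * \<psi> r)"

lemma weyl_eigen_iff:
  assumes "\<psi> \<in> carrier_vec D"
  shows "(\<exists>c. weyl d n a *\<^sub>v \<psi> = c \<cdot>\<^sub>v \<psi>) \<longleftrightarrow> (\<exists>c. zx_eigen (($) \<psi>) a c)"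
proof -
  have eq: "weyl d n a *\<^sub>v \<psi> = c \<cdot>\<^sub>v \<psi> \<longleftrightarrow> zx_eigen (($) \<psi>) a (c / label_phase a)" for c
  proof -
    have "weyl d n a *\<^sub>v \<psi> = c \<cdot>\<^sub>v \<psi> \<longleftrightarrow> (\<forall>r<D. (weyl d n a *\<^sub>v \<psi>) $ r = (c \<cdot>\<^sub>v \<psi>) $ r)"
      using assms by (auto simp: vec_eq_iff weyl_def)
    also have "\<dots> \<longleftrightarrow> zx_eigen (($) \<psi>) a (c / label_phase a)"
      unfolding zx_eigen_def using assms
      by (intro all_cong) (auto simp: weyl_mult_vec[OF assms] field_simps)
    finally show ?thesis .
  qed
  have "zx_eigen (($) \<psi>) a c \<Longrightarrow> weyl d n a *\<^sub>v \<psi> = (c * label_phase a) \<cdot>\<^sub>v \<psi>" for c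
    by (subst eq) simp
  with eq show ?thesis by blast
qed

lemma norm_zx_image:
  "(\<Sum>r<D. (cmod (character p r * \<psi> (unshift r q)))\<^sup>2) = (\<Sum>r<D. (cmod (\<psi> r))\<^sup>2)"
proof -
  have "(\<Sum>r<D. (cmod (character p r * \<psi> (unshift r q)))\<^sup>2) = (\<Sum>r<D. (cmod (\<psi> (unshift r q)))\<^sup>2)"
    by (simp add: norm_mult)
  also have "\<dots> = (\<Sum>r<D. (cmod (\<psi> r))\<^sup>2)"
    by (rule sum.reindex_bij_betw[OF bij_unshift])
  finally show ?thesis .
qed

text \<open>\<open>Z^p X^q\<close> preserves the norm, so the eigenvalue has modulus one.\<close>

lemma zx_eigen_norm:
  assumes "(\<Sum>r<D. (cmod (\<psi> r))\<^sup>2) = 1" "zx_eigen \<psi> a c"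
  shows "cmod c = 1"
proof -
  have "(\<Sum>r<D. (cmod (character (fst a) r * \<psi> (unshift r (snd a))))\<^sup>2) = (\<Sum>r<D. (cmod c)\<^sup>2 * (cmod (\<psi> r))\<^sup>2)"
    using assms(2) by (intro sum.cong) (auto simp: zx_eigen_def norm_mult power_mult_distrib)
  also have "\<dots> = (cmod c)\<^sup>2" using assms(1) by (simp flip: sum_distrib_left)
  finally have "(cmod c)\<^sup>2 = 1" unfolding norm_zx_image assms(1) ..
  then show ?thesis using norm_ge_zero[of c] by (auto simp: power2_eq_1_iff simp del: norm_ge_zero)
qed

text \<open>For a pure state \<open>charfn\<close> is the inner product of the unit vectors
  \<open>\<psi>\<close> and \<open>Z^p X^q \<psi>\<close>; modulus one is the equality case of
  Cauchy--Schwarz.\<close>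

lemma norm_charfn_pure_eq_1_iff:
  assumes unit: "(\<Sum>r<D. (cmod (\<psi> r))\<^sup>2) = 1"
    and R: "\<And>i j. i < D \<Longrightarrow> j < D \<Longrightarrow> R i j = \<psi> i * cnj (\<psi> j)"
  shows "cmod (charfn R a) = 1 \<longleftrightarrow> (\<exists>c. zx_eigen \<psi> a c)"
proof -
  let ?\<phi> = "\<lambda>r. character (fst a) r * \<psi> (unshift r (snd a))"
  have F: "charfn R a = (\<Sum>r<D. ?\<phi> r * cnj (\<psi> r))"
    unfolding charfn_def by (intro sum.cong) (auto simp: R mult_ac)
  show ?thesis
  proof
    assume "cmod (charfn R a) = 1"
    then have "\<forall>r<D. ?\<phi> r = charfn R a * \<psi> r"
      by (intro unit_vectors_parallel unit F) (simp_all add: norm_zx_image unit)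
    then show "\<exists>c. zx_eigen \<psi> a c" unfolding zx_eigen_def by blast
  next
    assume "\<exists>c. zx_eigen \<psi> a c"
    then obtain c where c: "zx_eigen \<psi> a c" ..
    have "charfn R a = (\<Sum>r<D. c * of_real ((cmod (\<psi> r))\<^sup>2))"
      unfolding F using c by (intro sum.cong) (auto simp: zx_eigen_def complex_norm_square simp del: of_real_power)
    also have "\<dots> = c" using unit by (simp flip: sum_distrib_left of_real_sum of_real_power)
    finally show "cmod (charfn R a) = 1" using zx_eigen_norm[OF unit c] by simp
  qed
qed

text \<open>The two eigenvector equations are applied in succession; the \<open>chi\<close> factor
  compensates for evaluating the second character at a shifted index.\<close>

lemma zx_eigen_mult:
  assumes a: "zx_eigen \<psi> a ca" and b: "zx_eigen \<psi> b cb" and r: "r < D"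
  shows "character (fst a) r * character (fst b) r * \<psi> (unshift r (\<lambda>k. snd a k + snd b k))
    = chi d (\<Sum>k<n. fst b k * snd a k) * ca * cb * \<psi> r"
proof -
  let ?x = "chi d (\<Sum>k<n. fst b k * snd a k)"
  have x: "?x * cnj ?x = 1" by (simp flip: complex_norm_square)
  have "character (fst b) (unshift r (snd a)) * \<psi> (unshift (unshift r (snd a)) (snd b)) = cb * \<psi> (unshift r (snd a))"
    using b unfolding zx_eigen_def by simp
  then have "?x * cnj ?x * character (fst b) r * \<psi> (unshift r (\<lambda>k. snd a k + snd b k)) = ?x * cb * \<psi> (unshift r (snd a))"
    by (simp add: character_unshift unshift_unshift chi_minus mult.assoc)
  then have "character (fst a) r * character (fst b) r * \<psi> (unshift r (\<lambda>k. snd a k + snd b k))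
      = ?x * cb * (character (fst a) r * \<psi> (unshift r (snd a)))"
    unfolding x by simp
  also have "\<dots> = ?x * cb * (ca * \<psi> r)" using a r unfolding zx_eigen_def by simp
  finally show ?thesis by (simp add: mult_ac)
qed

lemma zx_eigen_label_add:
  assumes "zx_eigen \<psi> a ca" "zx_eigen \<psi> b cb"
  shows "\<exists>c. zx_eigen \<psi> (label_add d a b) c"
proof -
  have ch: "character (fst (label_add d a b)) r = character (fst a) r * character (fst b) r" for r
    unfolding character_add[symmetric] by (rule character_cong) (simp add: label_add_def)
  have un: "unshift r (snd (label_add d a b)) = unshift r (\<lambda>k. snd a k + snd b k)" for r
    by (rule unshift_cong) (simp add: label_add_def)
  show ?thesis unfolding zx_eigen_def ch un using zx_eigen_mult[OF assms] by blast
qed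

text \<open>The left side of \<open>zx_eigen_mult\<close> is symmetric in \<open>a\<close> and
  \<open>b\<close>. Comparing the right sides where \<open>\<psi>\<close> is nonzero and cancelling
  the nonzero eigenvalues equates the two commutation factors.\<close>

lemma zx_eigen_commute:
  assumes unit: "(\<Sum>r<D. (cmod (\<psi> r))\<^sup>2) = 1"
    and a: "zx_eigen \<psi> a ca" and b: "zx_eigen \<psi> b cb"
  shows "weyl d n a * weyl d n b = weyl d n b * weyl d n a"
proof (rule weyl_commute)
  have "\<exists>r<D. \<psi> r \<noteq> 0"
  proof (rule ccontr)
    assume "\<not> ?thesis"
    then have "(\<Sum>r<D. (cmod (\<psi> r))\<^sup>2) = 0" by simp
    with unit show False by simp
  qed
  then obtain r where r: "r < D" "\<psi> r \<noteq> 0" by blast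
  have nz: "ca \<noteq> 0" "cb \<noteq> 0" using zx_eigen_norm[OF unit a] zx_eigen_norm[OF unit b] by auto
  have "chi d (\<Sum>k<n. fst b k * snd a k) * ca * cb * \<psi> r = chi d (\<Sum>k<n. fst a k * snd b k) * cb * ca * \<psi> r"
    using zx_eigen_mult[OF a b r(1)] zx_eigen_mult[OF b a r(1)] by (simp add: add.commute mult_ac)
  then show "chi d (\<Sum>k<n. fst b k * snd a k) = chi d (\<Sum>k<n. fst a k * snd b k)"
    using nz r(2) by simp
qed

section \<open>Characteristic functions of states\<close>

text \<open>Each entry is bounded by the mean of two diagonal entries. The shift permutes the
  diagonal, so both diagonal sums equal the trace.\<close>

lemma norm_charfn_le_1:
  assumes "density_matrix D \<rho>"
  shows "cmod (charfn (\<lambda>i j. \<rho> $$ (i, j)) a) \<le> 1"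
proof -
  let ?R = "\<lambda>i j. \<rho> $$ (i, j)"
  have psd: "psd_kernel D ?R" and tr: "(\<Sum>i<D. ?R i i) = 1"
    using assms by (auto simp: density_matrix_iff_psd_kernel)
  have tr': "(\<Sum>i<D. Re (?R i i)) = 1" using tr by (simp flip: Re_sum)
  have "cmod (charfn ?R a) \<le> (\<Sum>r<D. cmod (?R (unshift r (snd a)) r))"
    unfolding charfn_def by (rule order.trans[OF norm_sum]) (simp add: norm_mult)
  also have "\<dots> \<le> (\<Sum>r<D. (Re (?R (unshift r (snd a)) (unshift r (snd a))) + Re (?R r r)) / 2)"
    by (intro sum_mono psd_kernel_norm_le_mean[OF psd]) auto
  also have "\<dots> = ((\<Sum>r<D. Re (?R (unshift r (snd a)) (unshift r (snd a)))) + (\<Sum>r<D. Re (?R r r))) / 2"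
    by (simp add: sum.distrib flip: sum_divide_distrib)
  also have "(\<Sum>r<D. Re (?R (unshift r (snd a)) (unshift r (snd a)))) = (\<Sum>r<D. Re (?R r r))"
    by (rule sum.reindex_bij_betw[OF bij_unshift])
  finally show ?thesis using tr' by simp
qed

lemma sum_norm_charfn_le:
  assumes "density_matrix D \<rho>"
  shows "(\<Sum>a\<in>labels d n. (cmod (charfn (\<lambda>i j. \<rho> $$ (i, j)) a))\<^sup>2) \<le> real D"
  using psd_kernel_purity_le_1[of D "\<lambda>i j. \<rho> $$ (i, j)"] assms
  unfolding charfn_parseval density_matrix_iff_psd_kernel by (simp add: mult_left_le)

lemma stabilizer_state_norm_charfn:
  assumes "is_pure_stabilizer_state d n \<rho> S" "a \<in> S"
  shows "cmod (charfn (\<lambda>i j. \<rho> $$ (i, j)) a) = 1"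
proof -
  from assms obtain \<psi> where \<psi>: "\<psi> \<in> carrier_vec D" "(\<Sum>i<D. (cmod (\<psi> $ i))\<^sup>2) = 1" "\<rho> = proj_of D \<psi>"
    and c: "\<exists>c. weyl d n a *\<^sub>v \<psi> = c \<cdot>\<^sub>v \<psi>"
    unfolding is_pure_stabilizer_state_def by blast
  show ?thesis
    using c unfolding weyl_eigen_iff[OF \<psi>(1)]
    by (subst norm_charfn_pure_eq_1_iff[OF \<psi>(2)]) (auto simp: \<psi>(3) proj_of_def)
qed

text \<open>The total forces purity one, hence a state vector. The labels of modulus one are those
  having it as eigenvector, which gives closure and commutation; as all moduli are 0 or 1, the total
  also counts these labels.\<close>

lemma stabilizer_state_of_charfn:
  assumes dens: "density_matrix D \<rho>"
    and total: "(\<Sum>a\<in>labels d n. (cmod (charfn (\<lambda>i j. \<rho> $$ (i, j)) a))\<^sup>2) = real D"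
    and zero_one: "\<And>a. a \<in> labels d n \<Longrightarrow> cmod (charfn (\<lambda>i j. \<rho> $$ (i, j)) a) \<in> {0, 1}"
  shows "is_pure_stabilizer_state d n \<rho> {a \<in> labels d n. cmod (charfn (\<lambda>i j. \<rho> $$ (i, j)) a) = 1}"
    (is "is_pure_stabilizer_state d n \<rho> ?S")
proof -
  let ?R = "\<lambda>i j. \<rho> $$ (i, j)"
  have \<rho>: "\<rho> \<in> carrier_mat D D" and psd: "psd_kernel D ?R" and tr: "(\<Sum>i<D. ?R i i) = 1"
    using dens by (auto simp: density_matrix_iff_psd_kernel)
  have "(\<Sum>i<D. \<Sum>j<D. (cmod (?R i j))\<^sup>2) = 1" using total unfolding charfn_parseval by simp
  from psd_kernel_pure[OF psd tr this] obtain \<psi> where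
    unit: "(\<Sum>i<D. (cmod (\<psi> i))\<^sup>2) = 1" and R: "\<forall>i<D. \<forall>j<D. ?R i j = \<psi> i * cnj (\<psi> j)"
    by (elim exE conjE) (rule that)
  have eig: "cmod (charfn ?R a) = 1 \<longleftrightarrow> (\<exists>c. zx_eigen \<psi> a c)" for a
    by (rule norm_charfn_pure_eq_1_iff[OF unit]) (simp add: R)
  have S_eig: "\<exists>c. zx_eigen \<psi> a c" if "a \<in> ?S" for a
    using that by (simp add: eig)
  define v where "v = vec D \<psi>"
  have v: "v \<in> carrier_vec D" by (simp add: v_def)
  have "zx_eigen (($) v) a = zx_eigen \<psi> a" for a
    unfolding zx_eigen_def v_def by (simp add: fun_eq_iff)
  then have weyl_eig: "\<exists>c. weyl d n a *\<^sub>v v = c \<cdot>\<^sub>v v" if "a \<in> ?S" for a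
    using S_eig[OF that] unfolding weyl_eigen_iff[OF v] by simp
  have card: "card ?S = D"
  proof -
    have "real (card ?S) = (\<Sum>a\<in>?S. (cmod (charfn ?R a))\<^sup>2)" by simp
    also have "\<dots> = (\<Sum>a\<in>labels d n. (cmod (charfn ?R a))\<^sup>2)"
      using zero_one by (intro sum.mono_neutral_left) auto
    finally show ?thesis using total by linarith
  qed
  have zero: "((\<lambda>k. 0), (\<lambda>k. 0)) \<in> ?S"
  proof -
    \<comment> \<open>At the zero label the characteristic function is the trace.\<close>
    have "charfn ?R ((\<lambda>k. 0), (\<lambda>k. 0)) = (\<Sum>r<D. ?R r r)"
      unfolding charfn_def by (intro sum.cong) (auto simp: unshift_0 character_def)
    then show ?thesis using tr by (simp add: labels_def)
  qed
  have add: "label_add d a b \<in> ?S" if ab: "a \<in> ?S" "b \<in> ?S" for a b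
  proof -
    have "label_add d a b \<in> labels d n"
      using ab by (auto simp: label_add_def labels_def)
    moreover obtain ca cb where "zx_eigen \<psi> a ca" "zx_eigen \<psi> b cb"
      using S_eig[OF ab(1)] S_eig[OF ab(2)] by blast
    ultimately show ?thesis using zx_eigen_label_add eig by simp
  qed
  have comm: "weyl d n a * weyl d n b = weyl d n b * weyl d n a" if "a \<in> ?S" "b \<in> ?S" for a b
    using S_eig[OF that(1)] S_eig[OF that(2)] zx_eigen_commute[OF unit] by blast
  have v_unit: "(\<Sum>i<D. (cmod (v $ i))\<^sup>2) = 1" using unit by (simp add: v_def)
  have proj: "\<rho> = proj_of D v"
    using \<rho> R by (intro eq_matI) (auto simp: proj_of_def v_def)
  have sub: "?S \<subseteq> labels d n" by (rule Collect_restrict)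
  show ?thesis
    unfolding is_pure_stabilizer_state_def
    by (intro conjI ballI exI[of _ v] sub card zero add comm v v_unit proj weyl_eig)
qed

end

text \<open>The differences \<open>f - f g\<close> and \<open>g - f g\<close> are nonnegative with
  sums at most zero, so they vanish pointwise; \<open>f (1 - g) = 0\<close> and
  \<open>g (1 - f) = 0\<close> leave only equal values in \<open>{0, 1}\<close>.\<close>

lemma sum_le_and_sum_mult_eq:
  fixes f g :: "'a \<Rightarrow> real"
  assumes "finite A" "\<And>x. x \<in> A \<Longrightarrow> 0 \<le> f x \<and> f x \<le> 1 \<and> 0 \<le> g x \<and> g x \<le> 1"
    and "sum f A \<le> c" "sum g A \<le> c" "(\<Sum>x\<in>A. f x * g x) = c"
  shows "sum f A = c" "sum g A = c" "\<And>x. x \<in> A \<Longrightarrow> f x = g x \<and> f x \<in> {0, 1}"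
proof -
  have nonneg: "0 \<le> f x - f x * g x" "0 \<le> g x - f x * g x" if "x \<in> A" for x
    using assms(2)[OF that] by (simp_all add: mult_left_le mult_left_le_one_le)
  have "(\<Sum>x\<in>A. f x - f x * g x) \<le> 0" "(\<Sum>x\<in>A. g x - f x * g x) \<le> 0"
    using assms(3-5) by (simp_all add: sum_subtractf)
  moreover have "0 \<le> (\<Sum>x\<in>A. f x - f x * g x)" "0 \<le> (\<Sum>x\<in>A. g x - f x * g x)"
    by (auto intro!: sum_nonneg nonneg)
  ultimately have 0: "(\<Sum>x\<in>A. f x - f x * g x) = 0" "(\<Sum>x\<in>A. g x - f x * g x) = 0" by linarith+
  then show "sum f A = c" "sum g A = c" using assms(5) by (simp_all add: sum_subtractf)
  fix x assume x: "x \<in> A"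
  have "f x - f x * g x = 0" "g x - f x * g x = 0"
    using 0 x nonneg assms(1) by (simp_all add: sum_nonneg_eq_0_iff)
  then have "f x = 0 \<or> g x = 1" "g x = 0 \<or> f x = 1" by simp_all
  then show "f x = g x \<and> f x \<in> {0, 1}" by auto
qed

lemma mod_linear_combination:
  fixes x y u v m :: int
  shows "(u * (x mod m) + v * (y mod m)) mod m = (u * x + v * y) mod m"
    and "(u * (x mod m) - v * (y mod m)) mod m = (u * x - v * y) mod m"
  by (intro mod_add_cong mod_diff_cong mod_mult_cong; simp)+

lemma index_mult_add_less:
  fixes a b D :: nat
  assumes "a < D" "b < D"
  shows "a * D + b < D * D"
proof -
  have "a * D + b < Suc a * D" using assms(2) by simp
  also have "\<dots> \<le> D * D" using assms(1) by (intro mult_right_mono) auto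
  finally show ?thesis .
qed

context qudits
begin

section \<open>Invertible scalings of Weyl labels\<close>

text \<open>Covers both \<open>stab_map\<close> and the change of labels caused by convolution; the
  reduction mod \<open>d\<close> keeps the result in \<open>labels\<close>.\<close>

definition scale_label :: "int \<Rightarrow> int \<Rightarrow> (nat \<Rightarrow> int) \<times> (nat \<Rightarrow> int) \<Rightarrow> (nat \<Rightarrow> int) \<times> (nat \<Rightarrow> int)" where
  "scale_label u v a = ((\<lambda>k. (u * fst a k) mod int d), (\<lambda>k. (v * snd a k) mod int d))"

lemma coprime_d: "\<not> int d dvd u \<Longrightarrow> coprime u (int d)"
  using prime_imp_coprime[of "int d" u] prime_d by (simp add: coprime_commute)

lemma mod_inverse_mult:
  assumes "\<not> int d dvd u"
  shows "(u * modular_inverse (int d) u) mod int d = 1"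
  using cong_modular_inverse1[OF coprime_d[OF assms]] prime_gt_1_nat[OF prime_d]
  by (simp add: cong_def)

lemma not_dvd_modular_inverse:
  assumes "\<not> int d dvd u"
  shows "\<not> int d dvd modular_inverse (int d) u"
proof
  assume "int d dvd modular_inverse (int d) u"
  then have "(u * modular_inverse (int d) u) mod int d = 0" by simp
  with mod_inverse_mult[OF assms] show False by simp
qed

lemma not_dvd_mult: "\<not> int d dvd u \<Longrightarrow> \<not> int d dvd v \<Longrightarrow> \<not> int d dvd u * v"
  using prime_d by (simp add: prime_dvd_mult_iff)

lemma mult_mult_mod_cancel:
  assumes "(u * w) mod int d = 1"
  shows "(u * (w * x)) mod int d = x mod int d"
proof -
  have "(u * (w * x)) mod int d = ((u * w) mod int d * x) mod int d"
    by (simp add: mod_simps mult.assoc)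
  then show ?thesis using assms by simp
qed

lemma digits_mod: "p \<in> digits d n \<Longrightarrow> p k mod int d = p k"
  by (cases "k < n") (simp_all add: digits_def)

lemma scale_digits: "p \<in> digits d n \<Longrightarrow> (\<lambda>k. (u * p k) mod int d) \<in> digits d n"
  by (simp add: digits_def)

lemma scale_label_in_labels: "a \<in> labels d n \<Longrightarrow> scale_label u v a \<in> labels d n"
  by (simp add: labels_eq scale_label_def mem_Times_iff scale_digits)

lemma scale_label_inverse:
  assumes "(u * u') mod int d = 1" "(v * v') mod int d = 1" "a \<in> labels d n"
  shows "scale_label u v (scale_label u' v' a) = a"
proof -
  have "fst a k mod int d = fst a k" "snd a k mod int d = snd a k" for k
    using assms(3) by (simp_all add: labels_eq mem_Times_iff digits_mod)
  then show ?thesis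
    by (simp add: scale_label_def mod_mult_right_eq mult_mult_mod_cancel[OF assms(1)]
        mult_mult_mod_cancel[OF assms(2)])
qed

lemma bij_scale_label:
  assumes "\<not> int d dvd u" "\<not> int d dvd v"
  shows "bij_betw (scale_label u v) (labels d n) (labels d n)"
proof -
  let ?u = "modular_inverse (int d) u" and ?v = "modular_inverse (int d) v"
  have inv: "(u * ?u) mod int d = 1" "(v * ?v) mod int d = 1" "(?u * u) mod int d = 1" "(?v * v) mod int d = 1"
    using mod_inverse_mult[OF assms(1)] mod_inverse_mult[OF assms(2)] by (simp_all only: mult.commute)
  show ?thesis
    by (rule bij_betwI[where g = "scale_label ?u ?v"])
      (simp_all add: scale_label_in_labels scale_label_inverse inv)
qed

text \<open>Permits unreduced integer labels, as they arise from linear formulas: characters and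
  shifts see only residues mod \<open>d\<close>.\<close>

lemma charfn_cong:
  assumes "\<And>k. k < n \<Longrightarrow> fst a k mod int d = fst b k mod int d"
    "\<And>k. k < n \<Longrightarrow> snd a k mod int d = snd b k mod int d"
  shows "charfn R a = charfn R b"
proof -
  have "character (fst a) r = character (fst b) r" "unshift r (snd a) = unshift r (snd b)" for r
    using assms by (auto intro: character_cong unshift_cong)
  then show ?thesis by (simp add: charfn_def)
qed

end

subsection \<open>Convolution\<close>

locale qudit_convolution = qudits +
  fixes g00 g01 g10 g11 :: int
  assumes g: "\<not> int d dvd g00" "\<not> int d dvd g01" "\<not> int d dvd g10" "\<not> int d dvd g11"
    and det: "\<not> int d dvd (g00 * g11 - g01 * g10)"
begin

definition N :: int where "N = modular_inverse (int d) (g00 * g11 - g01 * g10)"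

text \<open>The key unitary maps \<open>|x\<rangle>|y\<rangle>\<close> to \<open>|A x y\<rangle>|B x y\<rangle>\<close>; the maps \<open>X\<close> and \<open>Y\<close> are the components of the
  inverse index map.\<close>

definition X :: "nat \<Rightarrow> nat \<Rightarrow> nat" where "X a b = enc d n (\<lambda>k. g00 * dig d k a + g10 * dig d k b)"
definition Y :: "nat \<Rightarrow> nat \<Rightarrow> nat" where "Y a b = enc d n (\<lambda>k. g01 * dig d k a + g11 * dig d k b)"
definition A :: "nat \<Rightarrow> nat \<Rightarrow> nat" where "A x y = enc d n (\<lambda>k. N * g11 * dig d k x - N * g10 * dig d k y)"
definition B :: "nat \<Rightarrow> nat \<Rightarrow> nat" where "B x y = enc d n (\<lambda>k. - N * g01 * dig d k x + N * g00 * dig d k y)"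

lemma XYAB_less [simp]: "X a b < D" "Y a b < D" "A a b < D" "B a b < D"
  by (simp_all add: X_def Y_def A_def B_def)

lemma N_det: "(N * (g00 * g11 - g01 * g10)) mod int d = 1"
  unfolding N_def using mod_inverse_mult[OF det] by (simp add: mult.commute)

lemma N_det_mult: "(N * (g00 * g11 - g01 * g10) * x) mod int d = x mod int d"
  using mult_mult_mod_cancel[OF N_det] by (simp add: mult.assoc)

text \<open>On each digit, \<open>(A, B)\<close> applies \<open>N\<close> times the adjugate of the
  matrix behind \<open>(X, Y)\<close>, so the composition multiplies by \<open>N\<close> times the
  determinant, which is 1 mod \<open>d\<close>. The next three lemmas use the same
  cancellation.\<close>

lemma A_XY: "a < D \<Longrightarrow> A (X a b) (Y a b) = a"
proof (unfold A_def, rule enc_eqI)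
  fix k assume "k < n"
  then have "(N * g11 * dig d k (X a b) - N * g10 * dig d k (Y a b)) mod int d
      = (N * g11 * (g00 * dig d k a + g10 * dig d k b) - N * g10 * (g01 * dig d k a + g11 * dig d k b)) mod int d"
    by (simp only: X_def Y_def mod_linear_combination dig_enc)
  also have "\<dots> = (N * (g00 * g11 - g01 * g10) * dig d k a) mod int d"
    by (rule arg_cong[of _ _ "\<lambda>x. x mod int d"]) (simp add: algebra_simps)
  finally show "(N * g11 * dig d k (X a b) - N * g10 * dig d k (Y a b)) mod int d = dig d k a"
    by (simp add: N_det_mult)
qed

lemma B_XY: "b < D \<Longrightarrow> B (X a b) (Y a b) = b"
proof (unfold B_def, rule enc_eqI)
  fix k assume "k < n"
  then have "(- N * g01 * dig d k (X a b) + N * g00 * dig d k (Y a b)) mod int d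
      = (- N * g01 * (g00 * dig d k a + g10 * dig d k b) + N * g00 * (g01 * dig d k a + g11 * dig d k b)) mod int d"
    by (simp only: X_def Y_def mod_linear_combination dig_enc)
  also have "\<dots> = (N * (g00 * g11 - g01 * g10) * dig d k b) mod int d"
    by (rule arg_cong[of _ _ "\<lambda>x. x mod int d"]) (simp add: algebra_simps)
  finally show "(- N * g01 * dig d k (X a b) + N * g00 * dig d k (Y a b)) mod int d = dig d k b"
    by (simp add: N_det_mult)
qed

lemma X_AB: "x < D \<Longrightarrow> X (A x y) (B x y) = x"
proof (unfold X_def, rule enc_eqI)
  fix k assume "k < n"
  then have "(g00 * dig d k (A x y) + g10 * dig d k (B x y)) mod int d
      = (g00 * (N * g11 * dig d k x - N * g10 * dig d k y) + g10 * (- N * g01 * dig d k x + N * g00 * dig d k y)) mod int d"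
    by (simp only: A_def B_def mod_linear_combination dig_enc)
  also have "\<dots> = (N * (g00 * g11 - g01 * g10) * dig d k x) mod int d"
    by (rule arg_cong[of _ _ "\<lambda>x. x mod int d"]) (simp add: algebra_simps)
  finally show "(g00 * dig d k (A x y) + g10 * dig d k (B x y)) mod int d = dig d k x"
    by (simp add: N_det_mult)
qed

lemma Y_AB: "y < D \<Longrightarrow> Y (A x y) (B x y) = y"
proof (unfold Y_def, rule enc_eqI)
  fix k assume "k < n"
  then have "(g01 * dig d k (A x y) + g11 * dig d k (B x y)) mod int d
      = (g01 * (N * g11 * dig d k x - N * g10 * dig d k y) + g11 * (- N * g01 * dig d k x + N * g00 * dig d k y)) mod int d"
    by (simp only: A_def B_def mod_linear_combination dig_enc)
  also have "\<dots> = (N * (g00 * g11 - g01 * g10) * dig d k y) mod int d"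
    by (rule arg_cong[of _ _ "\<lambda>x. x mod int d"]) (simp add: algebra_simps)
  finally show "(g01 * dig d k (A x y) + g11 * dig d k (B x y)) mod int d = dig d k y"
    by (simp add: N_det_mult)
qed

lemma sum_XY: "(\<Sum>a<D. \<Sum>b<D. f (X a b) (Y a b)) = (\<Sum>x<D. \<Sum>y<D. f x y)"
proof -
  have "bij_betw (\<lambda>(a, b). (X a b, Y a b)) ({..<D} \<times> {..<D}) ({..<D} \<times> {..<D})"
    by (rule bij_betwI[where g = "\<lambda>(x, y). (A x y, B x y)"]) (auto simp: A_XY B_XY X_AB Y_AB)
  from sum.reindex_bij_betw[OF this, of "\<lambda>(x, y). f x y"] show ?thesis
    by (simp add: sum.cartesian_product case_prod_unfold)
qed

section \<open>The key unitary and the entries of the convolution\<close>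

abbreviation U :: "complex mat" where "U \<equiv> U_mat d n g00 g01 g10 g11"

lemma U_map_eq: "U_map d n g00 g01 g10 g11 c = A (c div D) (c mod D) * D + B (c div D) (c mod D)"
  by (simp add: U_map_def A_def B_def N_def Let_def)

text \<open>\<open>U\<close> is a permutation matrix defined column by column; inverting the index
  map describes it row by row, as the matrix products require.\<close>

lemma U_entry:
  assumes "a < D" "b < D" "c < D * D"
  shows "U $$ (a * D + b, c) = (if c = X a b * D + Y a b then 1 else 0)"
proof -
  let ?x = "c div D" and ?y = "c mod D"
  have x: "?x < D" using assms(3) by (simp add: less_mult_imp_div_less)
  have y: "?y < D" by simp
  have "a * D + b = A ?x ?y * D + B ?x ?y \<longleftrightarrow> a = A ?x ?y \<and> b = B ?x ?y"
  proof
    assume eq: "a * D + b = A ?x ?y * D + B ?x ?y"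
    have "(a * D + b) div D = a" "(a * D + b) mod D = b" using assms by auto
    moreover have "(A ?x ?y * D + B ?x ?y) div D = A ?x ?y" "(A ?x ?y * D + B ?x ?y) mod D = B ?x ?y" by auto
    ultimately show "a = A ?x ?y \<and> b = B ?x ?y" unfolding eq by simp
  qed simp
  also have "\<dots> \<longleftrightarrow> ?x = X a b \<and> ?y = Y a b"
    using A_XY[OF assms(1), of b] B_XY[OF assms(2), of a] X_AB[OF x, of ?y] Y_AB[OF y, of ?x] by metis
  also have "\<dots> \<longleftrightarrow> c = X a b * D + Y a b"
  proof
    assume "?x = X a b \<and> ?y = Y a b"
    then show "c = X a b * D + Y a b" using div_mult_mod_eq[of c D] by simp
  next
    assume "c = X a b * D + Y a b"
    then show "?x = X a b \<and> ?y = Y a b" by simp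
  qed
  finally show ?thesis
    using index_mult_add_less[OF assms(1,2)] assms(3) by (simp add: U_mat_def U_map_eq)
qed

lemma U_conj_entry:
  assumes K: "K \<in> carrier_mat (D * D) (D * D)" and ab: "a < D" "b < D" "a' < D" "b' < D"
  shows "(U * K * adj U) $$ (a * D + b, a' * D + b') = K $$ (X a b * D + Y a b, X a' b' * D + Y a' b')"
proof -
  note lt = index_mult_add_less[OF ab(1,2)] index_mult_add_less[OF ab(3,4)]
  have U: "U \<in> carrier_mat (D * D) (D * D)" by (simp add: U_mat_def)
  have UK: "(U * K) $$ (a * D + b, s) = K $$ (X a b * D + Y a b, s)" if "s < D * D" for s
  proof -
    have "(U * K) $$ (a * D + b, s) = (\<Sum>c<D * D. U $$ (a * D + b, c) * K $$ (c, s))"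
      using U K lt that by (simp add: scalar_prod_def atLeast0LessThan)
    also have "\<dots> = (\<Sum>c<D * D. if c = X a b * D + Y a b then K $$ (c, s) else 0)"
      by (intro sum.cong) (auto simp: U_entry ab)
    finally show ?thesis by (simp add: index_mult_add_less)
  qed
  have "(U * K * adj U) $$ (a * D + b, a' * D + b')
      = (\<Sum>s<D * D. (U * K) $$ (a * D + b, s) * adj U $$ (s, a' * D + b'))"
    using U K lt by (simp add: scalar_prod_def atLeast0LessThan adj_def)
  also have "\<dots> = (\<Sum>s<D * D. if s = X a' b' * D + Y a' b' then K $$ (X a b * D + Y a b, s) else 0)"
    using U lt by (intro sum.cong) (auto simp: UK adj_def U_entry ab)
  finally show ?thesis by (simp add: index_mult_add_less)
qed

lemma qconv_carrier [simp]: "qconv d n g00 g01 g10 g11 \<rho> \<sigma> \<in> carrier_mat D D"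
  by (simp add: qconv_def ptrace_B_def Let_def)

lemma qconv_entry:
  assumes "\<rho> \<in> carrier_mat D D" "\<sigma> \<in> carrier_mat D D" "a < D" "a' < D"
  shows "qconv d n g00 g01 g10 g11 \<rho> \<sigma> $$ (a, a') =
    (\<Sum>b<D. \<rho> $$ (X a b, X a' b) * \<sigma> $$ (Y a b, Y a' b))"
proof -
  have K: "kron \<rho> \<sigma> \<in> carrier_mat (D * D) (D * D)" using assms by (simp add: kron_def)
  have kron: "kron \<rho> \<sigma> $$ (x * D + y, x' * D + y') = \<rho> $$ (x, x') * \<sigma> $$ (y, y')"
    if "x < D" "y < D" "x' < D" "y' < D" for x y x' y'
    using assms that index_mult_add_less[OF that(1,2)] index_mult_add_less[OF that(3,4)]
    by (simp add: kron_def)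
  have "qconv d n g00 g01 g10 g11 \<rho> \<sigma> $$ (a, a')
      = (\<Sum>b<D. (U * kron \<rho> \<sigma> * adj U) $$ (a * D + b, a' * D + b))"
    using assms(3,4) by (simp add: qconv_def ptrace_B_def Let_def)
  also have "\<dots> = (\<Sum>b<D. \<rho> $$ (X a b, X a' b) * \<sigma> $$ (Y a b, Y a' b))"
    by (intro sum.cong) (auto simp: U_conj_entry[OF K] kron assms)
  finally show ?thesis .
qed

text \<open>For positivity both factors are written as sums of rank-one kernels, which turns the
  quadratic form into a sum of squared moduli. The trace follows by reindexing along
  \<open>(X, Y)\<close>.\<close>

lemma density_matrix_qconv:
  assumes "density_matrix D \<rho>" "density_matrix D \<sigma>"
  shows "density_matrix D (qconv d n g00 g01 g10 g11 \<rho> \<sigma>)"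
proof -
  let ?T = "\<lambda>a a'. qconv d n g00 g01 g10 g11 \<rho> \<sigma> $$ (a, a')"
  have \<rho>: "\<rho> \<in> carrier_mat D D" "psd_kernel D (\<lambda>i j. \<rho> $$ (i, j))" "(\<Sum>i<D. \<rho> $$ (i, i)) = 1"
    and \<sigma>: "\<sigma> \<in> carrier_mat D D" "psd_kernel D (\<lambda>i j. \<sigma> $$ (i, j))" "(\<Sum>i<D. \<sigma> $$ (i, i)) = 1"
    using assms unfolding density_matrix_iff_psd_kernel by blast+
  note entry = qconv_entry[OF \<rho>(1) \<sigma>(1)]
  have "psd_kernel D ?T"
    unfolding psd_kernel_def
  proof (intro conjI allI impI)
    fix i j assume "i < D" "j < D"
    then show "?T j i = cnj (?T i j)"
      by (simp add: entry psd_kernel_cnj[OF \<rho>(2)] psd_kernel_cnj[OF \<sigma>(2)])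
  next
    fix f
    obtain m :: nat and u where u: "\<forall>i<D. \<forall>j<D. \<rho> $$ (i, j) = (\<Sum>k<m. u k i * cnj (u k j))"
      using psd_kernel_decomposition[OF \<rho>(2)] by (elim exE) (rule that)
    obtain l :: nat and w where w: "\<forall>i<D. \<forall>j<D. \<sigma> $$ (i, j) = (\<Sum>k<l. w k i * cnj (w k j))"
      using psd_kernel_decomposition[OF \<sigma>(2)] by (elim exE) (rule that)
    \<comment> \<open>For fixed \<open>b\<close>, \<open>s\<close> and \<open>t\<close>, the part of
      the form at \<open>(a, a')\<close> becomes \<open>z b s t a * cnj (z b s t a')\<close>, whose
      sum over \<open>a\<close> and \<open>a'\<close> is a squared modulus.\<close>
    define z where "z = (\<lambda>b s t a. cnj (f a) * u s (X a b) * w t (Y a b))"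
    have swap: "(\<Sum>a<D. \<Sum>a'<D. \<Sum>i\<in>I. h i a a') = (\<Sum>i\<in>I. \<Sum>a<D. \<Sum>a'<D. h i a a')"
      for I :: "nat set" and h :: "nat \<Rightarrow> nat \<Rightarrow> nat \<Rightarrow> complex"
      by (simp only: sum.swap[of _ I])
    have "quad_form D ?T f = (\<Sum>a<D. \<Sum>a'<D. \<Sum>b<D. \<Sum>s<m. \<Sum>t<l. z b s t a * cnj (z b s t a'))"
      unfolding quad_form_def
    proof (intro sum.cong refl)
      fix a a' assume aa: "a \<in> {..<D}" "a' \<in> {..<D}"
      have "cnj (f a) * ?T a a' * f a' = (\<Sum>b<D. cnj (f a) * f a' *
          ((\<Sum>s<m. u s (X a b) * cnj (u s (X a' b))) * (\<Sum>t<l. w t (Y a b) * cnj (w t (Y a' b)))))"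
        using aa by (simp add: entry u w sum_distrib_left sum_distrib_right mult_ac)
      also have "\<dots> = (\<Sum>b<D. \<Sum>s<m. \<Sum>t<l. z b s t a * cnj (z b s t a'))"
        unfolding sum_product unfolding sum_distrib_left z_def by (intro sum.cong refl) (simp add: mult_ac)
      finally show "cnj (f a) * ?T a a' * f a' = (\<Sum>b<D. \<Sum>s<m. \<Sum>t<l. z b s t a * cnj (z b s t a'))" .
    qed
    also have "\<dots> = (\<Sum>b<D. \<Sum>a<D. \<Sum>a'<D. \<Sum>s<m. \<Sum>t<l. z b s t a * cnj (z b s t a'))"
      by (rule swap)
    also have "\<dots> = (\<Sum>b<D. \<Sum>s<m. \<Sum>a<D. \<Sum>a'<D. \<Sum>t<l. z b s t a * cnj (z b s t a'))"
      by (rule sum.cong[OF refl]) (rule swap)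
    also have "\<dots> = (\<Sum>b<D. \<Sum>s<m. \<Sum>t<l. \<Sum>a<D. \<Sum>a'<D. z b s t a * cnj (z b s t a'))"
      by (rule sum.cong[OF refl], rule sum.cong[OF refl]) (rule swap)
    also have "\<dots> = of_real (\<Sum>b<D. \<Sum>s<m. \<Sum>t<l. (cmod (\<Sum>a<D. z b s t a))\<^sup>2)"
      unfolding of_real_sum complex_norm_square cnj_sum sum_product ..
    finally have "Re (quad_form D ?T f) = (\<Sum>b<D. \<Sum>s<m. \<Sum>t<l. (cmod (\<Sum>a<D. z b s t a))\<^sup>2)"
      by (simp only: Re_complex_of_real)
    then show "0 \<le> Re (quad_form D ?T f)" by (simp add: sum_nonneg)
  qed
  moreover have "(\<Sum>a<D. ?T a a) = 1"
  proof -
    have "(\<Sum>a<D. ?T a a) = (\<Sum>a<D. \<Sum>b<D. \<rho> $$ (X a b, X a b) * \<sigma> $$ (Y a b, Y a b))"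
      by (simp add: entry)
    also have "\<dots> = (\<Sum>x<D. \<Sum>y<D. \<rho> $$ (x, x) * \<sigma> $$ (y, y))"
      by (rule sum_XY)
    also have "\<dots> = 1" unfolding sum_product[symmetric] \<rho>(3) \<sigma>(3) by simp
    finally show ?thesis .
  qed
  ultimately show ?thesis unfolding density_matrix_iff_psd_kernel by simp
qed

section \<open>The characteristic function of the convolution\<close>

lemma X_unshift: "X (unshift a q) b = unshift (X a b) (\<lambda>k. g00 * q k)"
proof (unfold X_def[of "unshift a q"], rule enc_eqI)
  fix k assume k: "k < n"
  have "(g00 * ((dig d k a - q k) mod int d) + g10 * dig d k b) mod int d
      = (g00 * (dig d k a - q k) + g10 * dig d k b) mod int d"
    using mod_linear_combination(1)[of g00 "dig d k a - q k" "int d" g10 "dig d k b"] by simp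
  also have "\<dots> = (g00 * dig d k a + g10 * dig d k b - g00 * q k) mod int d"
    by (rule arg_cong[of _ _ "\<lambda>x. x mod int d"]) (simp add: algebra_simps)
  finally show "(g00 * dig d k (unshift a q) + g10 * dig d k b) mod int d
      = dig d k (unshift (X a b) (\<lambda>k. g00 * q k))"
    using k by (simp add: dig_unshift X_def mod_diff_left_eq)
qed simp

lemma Y_unshift: "Y (unshift a q) b = unshift (Y a b) (\<lambda>k. g01 * q k)"
proof (unfold Y_def[of "unshift a q"], rule enc_eqI)
  fix k assume k: "k < n"
  have "(g01 * ((dig d k a - q k) mod int d) + g11 * dig d k b) mod int d
      = (g01 * (dig d k a - q k) + g11 * dig d k b) mod int d"
    using mod_linear_combination(1)[of g01 "dig d k a - q k" "int d" g11 "dig d k b"] by simp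
  also have "\<dots> = (g01 * dig d k a + g11 * dig d k b - g01 * q k) mod int d"
    by (rule arg_cong[of _ _ "\<lambda>x. x mod int d"]) (simp add: algebra_simps)
  finally show "(g01 * dig d k (unshift a q) + g11 * dig d k b) mod int d
      = dig d k (unshift (Y a b) (\<lambda>k. g01 * q k))"
    using k by (simp add: dig_unshift Y_def mod_diff_left_eq)
qed simp

text \<open>\<open>A\<close> is linear in its two inputs, so the exponent splits into a part for
  \<open>x\<close> and a part for \<open>y\<close>.\<close>

lemma character_A:
  "character p (A x y) = character (\<lambda>k. N * g11 * p k) x * character (\<lambda>k. - N * g10 * p k) y"
  unfolding A_def character_enc unfolding character_def chi_add[symmetric]
  by (simp add: algebra_simps sum.distrib sum_subtractf sum_negf)

text \<open>Convolution multiplies characteristic functions, as \<open>U\<close> conjugates \<open>Z\<^sup>p X\<^sup>q \<otimes> I\<close> into a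
  tensor product of Weyl operators.\<close>

lemma charfn_qconv:
  assumes "\<rho> \<in> carrier_mat D D" "\<sigma> \<in> carrier_mat D D"
  shows "charfn (\<lambda>i j. qconv d n g00 g01 g10 g11 \<rho> \<sigma> $$ (i, j)) a =
    charfn (\<lambda>i j. \<rho> $$ (i, j)) (\<lambda>k. N * g11 * fst a k, \<lambda>k. g00 * snd a k) *
    charfn (\<lambda>i j. \<sigma> $$ (i, j)) (\<lambda>k. - N * g10 * fst a k, \<lambda>k. g01 * snd a k)"
proof -
  let ?R = "\<lambda>x. \<rho> $$ (unshift x (\<lambda>k. g00 * snd a k), x) * character (\<lambda>k. N * g11 * fst a k) x"
  let ?S = "\<lambda>y. \<sigma> $$ (unshift y (\<lambda>k. g01 * snd a k), y) * character (\<lambda>k. - N * g10 * fst a k) y"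
  have "charfn (\<lambda>i j. qconv d n g00 g01 g10 g11 \<rho> \<sigma> $$ (i, j)) a = (\<Sum>r<D. \<Sum>b<D. ?R (X r b) * ?S (Y r b))"
    unfolding charfn_def
  proof (intro sum.cong refl)
    fix r assume r: "r \<in> {..<D}"
    have ch: "character (fst a) r = character (\<lambda>k. N * g11 * fst a k) (X r b) * character (\<lambda>k. - N * g10 * fst a k) (Y r b)" for b
      using character_A[of "fst a" "X r b" "Y r b"] r by (simp add: A_XY)
    have "qconv d n g00 g01 g10 g11 \<rho> \<sigma> $$ (unshift r (snd a), r) * character (fst a) r
      = (\<Sum>b<D. \<rho> $$ (X (unshift r (snd a)) b, X r b) * \<sigma> $$ (Y (unshift r (snd a)) b, Y r b) * character (fst a) r)"
      using r by (simp add: qconv_entry[OF assms] sum_distrib_right)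
    also have "\<dots> = (\<Sum>b<D. ?R (X r b) * ?S (Y r b))"
      unfolding X_unshift Y_unshift by (intro sum.cong refl) (subst ch, simp only: mult_ac)
    finally show "qconv d n g00 g01 g10 g11 \<rho> \<sigma> $$ (unshift r (snd a), r) * character (fst a) r
      = (\<Sum>b<D. ?R (X r b) * ?S (Y r b))" .
  qed
  also have "\<dots> = (\<Sum>x<D. \<Sum>y<D. ?R x * ?S y)" by (rule sum_XY)
  also have "\<dots> = (\<Sum>x<D. ?R x) * (\<Sum>y<D. ?S y)" by (rule sum_product[symmetric])
  finally show ?thesis by (simp add: charfn_def)
qed

lemma stab_map_eq: "stab_map d g00 g01 g10 g11 =
    scale_label (- modular_inverse (int d) g10 * g11) (modular_inverse (int d) g01 * g00)"
  by (simp add: stab_map_def scale_label_def fun_eq_iff)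

lemma bij_stab_map: "bij_betw (stab_map d g00 g01 g10 g11) (labels d n) (labels d n)"
  unfolding stab_map_eq by (rule bij_scale_label) (simp_all add: g not_dvd_mult not_dvd_modular_inverse)

text \<open>Taking the label of \<open>\<sigma>\<close> as the new variable, the label of
  \<open>\<rho>\<close> becomes its image under \<open>stab_map\<close>: the inverses of
  \<open>g10\<close> and \<open>g01\<close> cancel the scaling, leaving \<open>N g11 p\<close> and
  \<open>g00 q\<close>.\<close>

lemma charfn_qconv_stab_map:
  assumes "\<rho> \<in> carrier_mat D D" "\<sigma> \<in> carrier_mat D D"
  shows "charfn (\<lambda>i j. qconv d n g00 g01 g10 g11 \<rho> \<sigma> $$ (i, j)) a =
    charfn (\<lambda>i j. \<rho> $$ (i, j)) (stab_map d g00 g01 g10 g11 (scale_label (- N * g10) g01 a)) *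
    charfn (\<lambda>i j. \<sigma> $$ (i, j)) (scale_label (- N * g10) g01 a)"
proof -
  let ?i = "modular_inverse (int d)"
  have "(?i g10 * g10) mod int d = 1" "(?i g01 * g01) mod int d = 1"
    using mod_inverse_mult[of g10] mod_inverse_mult[of g01] g by (simp_all add: mult.commute)
  note inv = mult_mult_mod_cancel[OF this(1)] mult_mult_mod_cancel[OF this(2)]
  have 1: "(- ?i g10 * g11 * (- N * g10 * p)) mod int d = (N * g11 * p) mod int d"
    and 2: "(?i g01 * g00 * (g01 * q)) mod int d = (g00 * q) mod int d" for p q
    using inv(1)[of "N * g11 * p"] inv(2)[of "g00 * q"] by (simp_all add: mult_ac)
  have "charfn (\<lambda>i j. \<rho> $$ (i, j)) (stab_map d g00 g01 g10 g11 (scale_label (- N * g10) g01 a))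
      = charfn (\<lambda>i j. \<rho> $$ (i, j)) (\<lambda>k. N * g11 * fst a k, \<lambda>k. g00 * snd a k)"
    unfolding stab_map_eq
    by (rule charfn_cong) (simp_all only: scale_label_def fst_conv snd_conv mod_mult_right_eq mod_mod_trivial 1 2)
  moreover have "charfn (\<lambda>i j. \<sigma> $$ (i, j)) (scale_label (- N * g10) g01 a)
      = charfn (\<lambda>i j. \<sigma> $$ (i, j)) (\<lambda>k. - N * g10 * fst a k, \<lambda>k. g01 * snd a k)"
    by (rule charfn_cong) (simp_all add: scale_label_def)
  ultimately show ?thesis using charfn_qconv[OF assms] by simp
qed

text \<open>Zero entropy is purity one. Parseval expresses the purity through the product of
  characteristic functions, and the invertible scaling makes the label of \<open>\<sigma>\<close>
  the summation variable.\<close>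

lemma vN_entropy_qconv_eq_0_iff:
  assumes "density_matrix D \<rho>" "density_matrix D \<sigma>"
  shows "vN_entropy (qconv d n g00 g01 g10 g11 \<rho> \<sigma>) = 0 \<longleftrightarrow>
    (\<Sum>b\<in>labels d n. (cmod (charfn (\<lambda>i j. \<rho> $$ (i, j)) (stab_map d g00 g01 g10 g11 b)))\<^sup>2
      * (cmod (charfn (\<lambda>i j. \<sigma> $$ (i, j)) b))\<^sup>2) = real D"
proof -
  let ?T = "\<lambda>i j. qconv d n g00 g01 g10 g11 \<rho> \<sigma> $$ (i, j)"
  let ?h = "\<lambda>b. (cmod (charfn (\<lambda>i j. \<rho> $$ (i, j)) (stab_map d g00 g01 g10 g11 b)))\<^sup>2
      * (cmod (charfn (\<lambda>i j. \<sigma> $$ (i, j)) b))\<^sup>2"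
  have c: "\<rho> \<in> carrier_mat D D" "\<sigma> \<in> carrier_mat D D" using assms by (auto simp: density_matrix_def)
  have "\<not> int d dvd - N * g10"
    using not_dvd_mult[of N g10] not_dvd_modular_inverse[OF det] g by (simp add: N_def)
  then have bij: "bij_betw (scale_label (- N * g10) g01) (labels d n) (labels d n)"
    by (rule bij_scale_label) (rule g)
  have "real D * (\<Sum>i<D. \<Sum>j<D. (cmod (?T i j))\<^sup>2) = (\<Sum>a\<in>labels d n. (cmod (charfn ?T a))\<^sup>2)"
    by (rule charfn_parseval[symmetric])
  also have "\<dots> = (\<Sum>a\<in>labels d n. ?h (scale_label (- N * g10) g01 a))"
    by (simp only: charfn_qconv_stab_map[OF c] norm_mult power_mult_distrib)
  also have "\<dots> = (\<Sum>b\<in>labels d n. ?h b)"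
    by (rule sum.reindex_bij_betw[OF bij])
  finally have total: "real D * (\<Sum>i<D. \<Sum>j<D. (cmod (?T i j))\<^sup>2) = (\<Sum>b\<in>labels d n. ?h b)" .
  show ?thesis
    unfolding vN_entropy_eq_0_iff[OF density_matrix_qconv[OF assms]] total[symmetric] by simp
qed

theorem vN_entropy_qconv_eq_0_iff_stabilizer:
  assumes "density_matrix D \<rho>" "density_matrix D \<sigma>"
  shows "vN_entropy (qconv d n g00 g01 g10 g11 \<rho> \<sigma>) = 0 \<longleftrightarrow>
    (\<exists>S1 S2. is_pure_stabilizer_state d n \<rho> S1 \<and> is_pure_stabilizer_state d n \<sigma> S2
       \<and> S1 = stab_map d g00 g01 g10 g11 ` S2)"
proof -
  let ?T = "stab_map d g00 g01 g10 g11"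
  let ?F = "charfn (\<lambda>i j. \<rho> $$ (i, j))" and ?G = "charfn (\<lambda>i j. \<sigma> $$ (i, j))"
  define f where "f b = (cmod (?F (?T b)))\<^sup>2" for b
  define g where "g b = (cmod (?G b))\<^sup>2" for b
  have ent: "vN_entropy (qconv d n g00 g01 g10 g11 \<rho> \<sigma>) = 0 \<longleftrightarrow> (\<Sum>b\<in>labels d n. f b * g b) = real D"
    unfolding f_def g_def by (rule vN_entropy_qconv_eq_0_iff[OF assms])
  have reindex: "sum f (labels d n) = (\<Sum>a\<in>labels d n. (cmod (?F a))\<^sup>2)"
    unfolding f_def by (rule sum.reindex_bij_betw[OF bij_stab_map])
  have bounds: "0 \<le> f b \<and> f b \<le> 1 \<and> 0 \<le> g b \<and> g b \<le> 1" for b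
    using norm_charfn_le_1[OF assms(1), of "?T b"] norm_charfn_le_1[OF assms(2), of b]
    by (simp add: f_def g_def power_le_one)
  have le: "sum f (labels d n) \<le> real D" "sum g (labels d n) \<le> real D"
    unfolding reindex unfolding g_def
    by (rule sum_norm_charfn_le[OF assms(1)], rule sum_norm_charfn_le[OF assms(2)])
  show ?thesis
  proof
    assume "vN_entropy (qconv d n g00 g01 g10 g11 \<rho> \<sigma>) = 0"
    then have fg: "(\<Sum>b\<in>labels d n. f b * g b) = real D" unfolding ent .
    note eqs = sum_le_and_sum_mult_eq[of "labels d n" f g, OF finite_labels bounds le fg]
    have zo: "cmod (?F (?T b)) = cmod (?G b)" "cmod (?G b) \<in> {0, 1}" if "b \<in> labels d n" for b
    proof -
      have fg_eq: "f b = g b" "f b = 0 \<or> f b = 1" using eqs(3)[OF that] by auto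
      from fg_eq(1) show eq: "cmod (?F (?T b)) = cmod (?G b)"
        unfolding f_def g_def by (rule power2_eq_imp_eq) (rule norm_ge_zero)+
      have "(cmod (?G b))\<^sup>2 = 0 \<or> (cmod (?G b))\<^sup>2 = 1\<^sup>2" using fg_eq by (simp add: g_def)
      then have "cmod (?G b) = 0 \<or> cmod (?G b) = 1"
        by (metis norm_ge_zero power2_eq_imp_eq zero_eq_power2 zero_le_one)
      then show "cmod (?G b) \<in> {0, 1}" by simp
    qed
    \<comment> \<open>The moduli for \<open>\<rho>\<close> are known only at labels
      \<open>?T b\<close>; surjectivity of \<open>?T\<close> reaches every label.\<close>
    have img: "?T ` labels d n = labels d n" using bij_stab_map by (simp add: bij_betw_def)
    have "cmod (?F a) \<in> {0, 1}" if "a \<in> labels d n" for a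
    proof -
      from that have "a \<in> ?T ` labels d n" unfolding img .
      then show ?thesis using zo by (elim imageE) simp
    qed
    then have "is_pure_stabilizer_state d n \<rho> {a \<in> labels d n. cmod (?F a) = 1}"
      using eqs(1) unfolding reindex by (intro stabilizer_state_of_charfn[OF assms(1)])
    moreover have "is_pure_stabilizer_state d n \<sigma> {b \<in> labels d n. cmod (?G b) = 1}"
      using eqs(2) zo(2) unfolding g_def by (intro stabilizer_state_of_charfn[OF assms(2)])
    moreover have "{a \<in> labels d n. cmod (?F a) = 1} = ?T ` {b \<in> labels d n. cmod (?G b) = 1}"
    proof -
      have "{a \<in> ?T ` labels d n. cmod (?F a) = 1} = ?T ` {b \<in> labels d n. cmod (?F (?T b)) = 1}"
        by blast
      also have "{b \<in> labels d n. cmod (?F (?T b)) = 1} = {b \<in> labels d n. cmod (?G b) = 1}"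
        using zo(1) by (intro Collect_cong conj_cong refl) simp
      finally show ?thesis unfolding img .
    qed
    ultimately show "\<exists>S1 S2. is_pure_stabilizer_state d n \<rho> S1 \<and> is_pure_stabilizer_state d n \<sigma> S2 \<and> S1 = ?T ` S2"
      by (intro exI conjI)
  next
    assume "\<exists>S1 S2. is_pure_stabilizer_state d n \<rho> S1 \<and> is_pure_stabilizer_state d n \<sigma> S2 \<and> S1 = ?T ` S2"
    then obtain S where S1: "is_pure_stabilizer_state d n \<rho> (?T ` S)" and S2: "is_pure_stabilizer_state d n \<sigma> S"
      by (elim exE conjE) (simp only:)
    have S: "S \<subseteq> labels d n" "card S = D" using S2 by (auto simp: is_pure_stabilizer_state_def)
    \<comment> \<open>Both moduli are 1 on the stabilizer labels, so the sum counts the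
      \<open>d ^ n\<close> elements of \<open>S\<close>.\<close>
    have "real D = (\<Sum>b\<in>S. f b * g b)"
      using stabilizer_state_norm_charfn[OF S1] stabilizer_state_norm_charfn[OF S2] S(2)
      by (simp add: f_def g_def)
    also have "\<dots> \<le> (\<Sum>b\<in>labels d n. f b * g b)"
      using S(1) bounds by (intro sum_mono2 mult_nonneg_nonneg) auto
    finally have "real D \<le> (\<Sum>b\<in>labels d n. f b * g b)" .
    \<comment> \<open>Since \<open>g\<close> is at most 1, the purity bound for
      \<open>\<rho>\<close> caps the full sum at \<open>d ^ n\<close> as well, which forces
      equality.\<close>
    moreover have "(\<Sum>b\<in>labels d n. f b * g b) \<le> sum f (labels d n)"
      using bounds by (intro sum_mono mult_left_le) auto
    ultimately show "vN_entropy (qconv d n g00 g01 g10 g11 \<rho> \<sigma>) = 0"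
      using ent le(1) by linarith
  qed
qed

end

theorem mainTheorem14:
  fixes d n :: nat and g00 g01 g10 g11 :: int and \<rho> \<sigma> :: "complex mat"
  assumes "prime d" and "n \<ge> 1"
    and "\<not> int d dvd g00" and "\<not> int d dvd g01" and "\<not> int d dvd g10" and "\<not> int d dvd g11"
    and "\<not> int d dvd (g00 * g11 - g01 * g10)"
    and "density_matrix (d ^ n) \<rho>" and "density_matrix (d ^ n) \<sigma>"
  shows "vN_entropy (qconv d n g00 g01 g10 g11 \<rho> \<sigma>) = 0 \<longleftrightarrow>
    (\<exists>S1 S2. is_pure_stabilizer_state d n \<rho> S1 \<and> is_pure_stabilizer_state d n \<sigma> S2
       \<and> S1 = stab_map d g00 g01 g10 g11 ` S2)"
proof -
  interpret qudit_convolution d n g00 g01 g10 g11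
    using assms by unfold_locales auto
  show ?thesis using assms(8,9) by (rule vN_entropy_qconv_eq_0_iff_stabilizer)
qed

end
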